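(* Let $A,B:\mathrm{dom}\,A\to\mathbb{R}^{m_\zeta\times m_\zeta}$ have the same hybrid time domain and consider the hybrid system $$\mathcal{H}'_0:\quad\begin{cases}\dot\zeta=-A(t,j)\zeta, & t\in\mathrm{int}(I^j_A),\\ \zeta^+=[I_{m_\zeta}-B(t,j)]\zeta, & (t,j),(t,j+1)\in\mathrm{dom}\,A.\end{cases}$$ Assume that: (1) (uniform boundedness) there exist $\bar A,\bar B>0$ such that $|A(t,j)|\le\bar A$ and $|B(t,j)|\le\bar B$ for all $(t,j)\in\mathrm{dom}\,A$; (2) (structural properties) for each $(t,j)\in\mathrm{dom}\,A$, $A(t,j)=A(t,j)^\top\ge0$, $B(t,j)=B(t,j)^\top\ge0$, and $|B(t,j)|\le1$; (3) the pair $(A,B)$ is hybrid persistently exciting (HPE). Then the pair $(A,B)$ is hybrid uniformly observable (HUO).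
   Context: Hybrid time domains. A hybrid signal is a function on a hybrid time domain $\mathrm{dom}\subset\mathbb{R}_{\ge0}\times\mathbb{Z}_{\ge0}$, i.e. a set such that for each $(T,J)$ in it, its intersection with $[0,T]\times\{0,\dots,J\}$ is $\bigcup_{j=0}^J[t_j,t_{j+1}]\times\{j\}$ for some $0=t_0\le\dots\le t_{J+1}=T$. Put $I^j_A:=\{t:(t,j)\in\mathrm{dom}\,A\}$. A hybrid arc is a hybrid signal that is locally absolutely continuous in $t$ on each $I^j$. $|\cdot|$ is the Euclidean (induced) norm; matrix inequalities are in the semidefinite order. Hybrid integral. For $(t,j)\in\mathrm{dom}\,A$ and $K>0$, $E^A_{t,j,K}\subset\mathrm{dom}\,A$ is the shortest hybrid time domain starting from $(t,j)$, contained in $\mathrm{dom}\,A$, of length (elapsed ordinary time plus number of jumps) at least $K$. Writing $E^A_{t,j,K}=\bigcup_{i=j}^{m_K}[t_i,t_{i+1}]\times\{i\}$ with $t_j:=t$ and $t_{m_K+1}=:s_K$ (so $K\le(s_K-t)+(m_K-j)<K+1$), $$\int_{E^A_{t,j,K}}g(s,i)\,d(s,i):=\sum_{i=j}^{m_K}\int_{t_i}^{t_{i+1}}g(s,i)\,ds+\sum_{i=j}^{m_K-1}g(t_{i+1},i).$$ HPE. A pair $(A,B)$ of hybrid arcs $A,B:\mathrm{dom}\,A\to\mathbb{R}^{m_\zeta\times m_\zeta}$ with $\mathrm{dom}\,A=\mathrm{dom}\,B$ is HPE if there exist $K,\mu>0$ such that $$\int_{E^A_{t_o,j_o,K}}\Phi_{AB}(s,i)\,d(s,i)\ge\mu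 I_{m_\zeta}\qquad\forall(t_o,j_o)\in\mathrm{dom}\,A,$$ where $\Phi_{AB}(t,j):=A(t,j)$ if $t\in\mathrm{int}(I^j_A)$ and $\Phi_{AB}(t,j):=B(t,j)$ otherwise. Lyapunov inequalities. The pair $(A,B)$ satisfies the Lyapunov (non-strict) inequalities with $(P,Q_c,Q_d)$ if $P:\mathrm{dom}\,A\to\mathbb{R}^{m_\zeta\times m_\zeta}$ is symmetric with $p_1I_{m_\zeta}\le P(t,j)\le p_2I_{m_\zeta}$ for some constants $p_1,p_2>0$, $Q_c,Q_d:\mathrm{dom}\,A\to\mathbb{R}^{m_\zeta\times m_\zeta}$ are symmetric positive semidefinite, $\dot P(t,j)-A(t,j)^\top P(t,j)-P(t,j)A(t,j)\le-Q_c(t,j)$ for all $t\in\mathrm{int}(I^j_A)$, and $[I_{m_\zeta}-B(t,j)]^\top P(t,j+1)[I_{m_\zeta}-B(t,j)]-P(t,j)\le-Q_d(t,j)$ for all $(t,j)\in\mathrm{dom}\,A$ with $(t,j+1)\in\mathrm{dom}\,A$. Transition matrix. $\mathcal{M}((t,j),(t_o,j_o))$ solves $\dot{\mathcal{M}}((t,j),(t_o,j_o))=-A(t,j)\mathcal{M}((t,j),(t_o,j_o))$ for $t\in I^j_A$; $\mathcal{M}((t,j+1),(t_o,j_o))=[I_{m_\zeta}-B(t,j)]\mathcal{M}((t,j),(t_o,j_o))$ when $(t,j),(t,j+1)\in\mathrm{dom}\,A$; $\mathcal{M}((t_o,j_o),(t_o,j_o))=I_{m_\zeta}$. HUO. The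 pair $(A,B)$ is HUO if it satisfies the Lyapunov inequalities with some $(P,Q_c,Q_d)$ for which there exist $K,\mu>0$ such that, for each $(t_o,j_o)\in\mathrm{dom}\,A$, $$\int_{E^A_{t_o,j_o,K}}\mathcal{M}((s,i),(t_o,j_o))^\top\Phi(s,i)\,\mathcal{M}((s,i),(t_o,j_o))\,d(s,i)\ge\mu I_{m_\zeta},$$ where $\Phi(t,j):=Q_c(t,j)$ if $t\in\mathrm{int}(I^j_A)$ and $\Phi(t,j):=Q_d(t,j)$ otherwise. *)

theory Defs
  imports "HOL-Analysis.Analysis"
begin

section \<open>Matrices\<close>

text \<open>The type class norm on \<open>real^'n^'n\<close> is the Frobenius norm; the induced Euclidean norm is
  the operator norm of the associated linear map.\<close>

definition mat_norm :: "real^'n^'n \<Rightarrow> real" where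
  "mat_norm X = onorm (\<lambda>x. X *v x)"

definition psd :: "real^'n^'n \<Rightarrow> bool" where
  "psd X \<longleftrightarrow> transpose X = X \<and> (\<forall>x. 0 \<le> x \<bullet> (X *v x))"

definition psd_le :: "real^'n^'n \<Rightarrow> real^'n^'n \<Rightarrow> bool" (infix \<open>\<preceq>\<close> 50) where
  "X \<preceq> Y \<longleftrightarrow> psd (Y - X)"

section \<open>Hybrid time domains and hybrid arcs\<close>

definition htd_segment :: "nat \<Rightarrow> nat \<Rightarrow> (nat \<Rightarrow> real) \<Rightarrow> (real \<times> nat) set" where
  "htd_segment j m \<tau> = (\<Union>i\<in>{j..m}. {\<tau> i..\<tau> (Suc i)} \<times> {i})"

definition hybrid_time_domain :: "(real \<times> nat) set \<Rightarrow> bool" where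
  "hybrid_time_domain D \<longleftrightarrow> D \<subseteq> {0..} \<times> UNIV \<and>
     (\<forall>(T, J)\<in>D. \<exists>\<tau>. \<tau> 0 = 0 \<and> (\<forall>i\<le>J. \<tau> i \<le> \<tau> (Suc i)) \<and> \<tau> (Suc J) = T \<and>
        D \<inter> ({0..T} \<times> {0..J}) = htd_segment 0 J \<tau>)"

definition flow_interval :: "(real \<times> nat) set \<Rightarrow> nat \<Rightarrow> real set" where
  "flow_interval D j = {t. (t, j) \<in> D}"

text \<open>Absolute continuity on a compact interval: a division of a subset \<open>S\<close> is a finite family
  of non-overlapping compact intervals with union \<open>S\<close>.\<close>

definition abs_continuous_on_interval :: "real \<Rightarrow> real \<Rightarrow> (real \<Rightarrow> 'a::real_normed_vector) \<Rightarrow> bool"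
  where
  "abs_continuous_on_interval a b f \<longleftrightarrow>
     (\<forall>\<epsilon>>0. \<exists>\<delta>>0. \<forall>d S. d division_of S \<and> S \<subseteq> {a..b} \<and> (\<Sum>k\<in>d. Sup k - Inf k) < \<delta>
        \<longrightarrow> (\<Sum>k\<in>d. norm (f (Sup k) - f (Inf k))) < \<epsilon>)"

text \<open>A hybrid signal is represented by a total function of \<open>t\<close> and \<open>j\<close>; its values outside the
  domain \<open>D\<close> are irrelevant.\<close>

definition hybrid_arc :: "(real \<times> nat) set \<Rightarrow> (real \<Rightarrow> nat \<Rightarrow> 'a::real_normed_vector) \<Rightarrow> bool" where
  "hybrid_arc D X \<longleftrightarrow> hybrid_time_domain D \<and>
     (\<forall>j a b. {a..b} \<subseteq> flow_interval D j \<longrightarrow> abs_continuous_on_interval a b (\<lambda>t. X t j))"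

section \<open>Hybrid integrals\<close>

text \<open>\<open>segment_in D t j m \<tau>\<close>: the set \<open>htd_segment j m \<tau>\<close> is a compact hybrid time domain starting
  from \<open>(t, j)\<close> and contained in \<open>D\<close>. Only the breakpoints \<open>\<tau> j, \<dots>, \<tau> (m + 1)\<close> matter.\<close>

definition segment_in :: "(real \<times> nat) set \<Rightarrow> real \<Rightarrow> nat \<Rightarrow> nat \<Rightarrow> (nat \<Rightarrow> real) \<Rightarrow> bool" where
  "segment_in D t j m \<tau> \<longleftrightarrow>
     \<tau> j = t \<and> j \<le> m \<and> (\<forall>i\<in>{j..m}. \<tau> i \<le> \<tau> (Suc i)) \<and> htd_segment j m \<tau> \<subseteq> D"

definition segment_length :: "nat \<Rightarrow> nat \<Rightarrow> (nat \<Rightarrow> real) \<Rightarrow> real" where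
  "segment_length j m \<tau> = (\<tau> (Suc m) - \<tau> j) + (real m - real j)"

text \<open>The shortest such segment of length at least \<open>K\<close>. It is unique when it exists, and it
  exists iff \<open>D\<close> extends at least \<open>K\<close> beyond \<open>(t, j)\<close>.\<close>

definition shortest_window ::
  "(real \<times> nat) set \<Rightarrow> real \<Rightarrow> nat \<Rightarrow> real \<Rightarrow> nat \<Rightarrow> (nat \<Rightarrow> real) \<Rightarrow> bool" where
  "shortest_window D t j K m \<tau> \<longleftrightarrow>
     segment_in D t j m \<tau> \<and> K \<le> segment_length j m \<tau> \<and>
     (\<forall>m' \<tau>'. segment_in D t j m' \<tau>' \<and> K \<le> segment_length j m' \<tau>'
        \<longrightarrow> segment_length j m \<tau> \<le> segment_length j m' \<tau>')"

definition hybrid_integrable ::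
  "nat \<Rightarrow> nat \<Rightarrow> (nat \<Rightarrow> real) \<Rightarrow> (real \<Rightarrow> nat \<Rightarrow> 'a::euclidean_space) \<Rightarrow> bool" where
  "hybrid_integrable j m \<tau> g \<longleftrightarrow> (\<forall>i\<in>{j..m}. (\<lambda>s. g s i) integrable_on {\<tau> i..\<tau> (Suc i)})"

definition hybrid_integral ::
  "nat \<Rightarrow> nat \<Rightarrow> (nat \<Rightarrow> real) \<Rightarrow> (real \<Rightarrow> nat \<Rightarrow> 'a::euclidean_space) \<Rightarrow> 'a" where
  "hybrid_integral j m \<tau> g =
     (\<Sum>i=j..m. integral {\<tau> i..\<tau> (Suc i)} (\<lambda>s. g s i)) + (\<Sum>i=j..<m. g (\<tau> (Suc i)) i)"

text \<open>The hybrid integral of \<open>g\<close> over the window of length \<open>K\<close> from \<open>(t, j)\<close> exists and is at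
  least \<open>\<mu>\<close> times the identity.\<close>

definition window_integral_ge ::
  "(real \<times> nat) set \<Rightarrow> real \<Rightarrow> nat \<Rightarrow> real \<Rightarrow> real \<Rightarrow> (real \<Rightarrow> nat \<Rightarrow> real^'n^'n) \<Rightarrow> bool" where
  "window_integral_ge D t j K \<mu> g \<longleftrightarrow>
     (\<exists>m \<tau>. shortest_window D t j K m \<tau> \<and> hybrid_integrable j m \<tau> g \<and>
        \<mu> *\<^sub>R mat 1 \<preceq> hybrid_integral j m \<tau> g)"

definition flow_jump ::
  "(real \<times> nat) set \<Rightarrow> (real \<Rightarrow> nat \<Rightarrow> 'a) \<Rightarrow> (real \<Rightarrow> nat \<Rightarrow> 'a) \<Rightarrow> real \<Rightarrow> nat \<Rightarrow> 'a" where
  "flow_jump D X Y t j = (if t \<in> interior (flow_interval D j) then X t j else Y t j)"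

section \<open>Hybrid persistency of excitation and uniform observability\<close>

definition HPE ::
  "(real \<times> nat) set \<Rightarrow> (real \<Rightarrow> nat \<Rightarrow> real^'n^'n) \<Rightarrow> (real \<Rightarrow> nat \<Rightarrow> real^'n^'n) \<Rightarrow> bool" where
  "HPE D A B \<longleftrightarrow> hybrid_arc D A \<and> hybrid_arc D B \<and>
     (\<exists>K>0. \<exists>\<mu>>0. \<forall>(t\<^sub>0, j\<^sub>0)\<in>D. window_integral_ge D t\<^sub>0 j\<^sub>0 K \<mu> (flow_jump D A B))"

text \<open>\<open>P\<close> is a hybrid arc that is differentiable on the interior of every flow interval, so that
  its derivative in the flow inequality is meaningful at every point where it is used.\<close>

definition lyapunov_inequalities ::
  "(real \<times> nat) set \<Rightarrow> (real \<Rightarrow> nat \<Rightarrow> real^'n^'n) \<Rightarrow> (real \<Rightarrow> nat \<Rightarrow> real^'n^'n) \<Rightarrow>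
   (real \<Rightarrow> nat \<Rightarrow> real^'n^'n) \<Rightarrow> (real \<Rightarrow> nat \<Rightarrow> real^'n^'n) \<Rightarrow> (real \<Rightarrow> nat \<Rightarrow> real^'n^'n) \<Rightarrow> bool"
  where
  "lyapunov_inequalities D A B P Q\<^sub>c Q\<^sub>d \<longleftrightarrow>
     hybrid_arc D P \<and>
     (\<forall>(t, j)\<in>D. transpose (P t j) = P t j) \<and>
     (\<exists>p\<^sub>1>0. \<exists>p\<^sub>2>0. \<forall>(t, j)\<in>D. p\<^sub>1 *\<^sub>R mat 1 \<preceq> P t j \<and> P t j \<preceq> p\<^sub>2 *\<^sub>R mat 1) \<and>
     (\<forall>(t, j)\<in>D. psd (Q\<^sub>c t j) \<and> psd (Q\<^sub>d t j)) \<and>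
     (\<forall>j. \<forall>t\<in>interior (flow_interval D j).
        (\<lambda>s. P s j) differentiable (at t) \<and>
        vector_derivative (\<lambda>s. P s j) (at t) - transpose (A t j) ** P t j - P t j ** A t j
          \<preceq> - Q\<^sub>c t j) \<and>
     (\<forall>t j. (t, j) \<in> D \<and> (t, Suc j) \<in> D \<longrightarrow>
        transpose (mat 1 - B t j) ** P t (Suc j) ** (mat 1 - B t j) - P t j \<preceq> - Q\<^sub>d t j)"

text \<open>Only times after the initial one are constrained: solutions need not be continuable
  backwards through a jump, since \<open>I - B\<close> may be singular. The points of \<open>D\<close> after
  \<open>(t\<^sub>0, j\<^sub>0)\<close> are those with \<open>t\<^sub>0 \<le> t\<close> and \<open>j\<^sub>0 \<le> j\<close>.\<close>

definition transition_matrix ::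
  "(real \<times> nat) set \<Rightarrow> (real \<Rightarrow> nat \<Rightarrow> real^'n^'n) \<Rightarrow> (real \<Rightarrow> nat \<Rightarrow> real^'n^'n) \<Rightarrow>
   (real \<times> nat \<Rightarrow> real \<times> nat \<Rightarrow> real^'n^'n) \<Rightarrow> bool" where
  "transition_matrix D A B M \<longleftrightarrow>
     (\<forall>(t\<^sub>0, j\<^sub>0)\<in>D.
        M (t\<^sub>0, j\<^sub>0) (t\<^sub>0, j\<^sub>0) = mat 1 \<and>
        (\<forall>(t, j)\<in>D. t\<^sub>0 \<le> t \<and> j\<^sub>0 \<le> j \<longrightarrow>
           ((\<lambda>s. M (s, j) (t\<^sub>0, j\<^sub>0)) has_vector_derivative - (A t j ** M (t, j) (t\<^sub>0, j\<^sub>0)))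
             (at t within flow_interval D j \<inter> {t\<^sub>0..})) \<and>
        (\<forall>t j. (t, j) \<in> D \<and> (t, Suc j) \<in> D \<and> t\<^sub>0 \<le> t \<and> j\<^sub>0 \<le> j \<longrightarrow>
           M (t, Suc j) (t\<^sub>0, j\<^sub>0) = (mat 1 - B t j) ** M (t, j) (t\<^sub>0, j\<^sub>0)))"

definition HUO ::
  "(real \<times> nat) set \<Rightarrow> (real \<Rightarrow> nat \<Rightarrow> real^'n^'n) \<Rightarrow> (real \<Rightarrow> nat \<Rightarrow> real^'n^'n) \<Rightarrow> bool" where
  "HUO D A B \<longleftrightarrow>
     (\<exists>M. transition_matrix D A B M \<and>
       (\<exists>P Q\<^sub>c Q\<^sub>d. lyapunov_inequalities D A B P Q\<^sub>c Q\<^sub>d \<and>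
         (\<exists>K>0. \<exists>\<mu>>0. \<forall>(t\<^sub>0, j\<^sub>0)\<in>D.
            window_integral_ge D t\<^sub>0 j\<^sub>0 K \<mu>
              (\<lambda>s i. transpose (M (s, i) (t\<^sub>0, j\<^sub>0)) ** flow_jump D Q\<^sub>c Q\<^sub>d s i ** M (s, i) (t\<^sub>0, j\<^sub>0)))))"

end

theory Submission
  imports Defs
begin

text \<open>The Lyapunov function \<open>|\<zeta>|\<^sup>2\<close>, that is \<open>P = I\<close>, satisfies the inequalities with \<open>Q\<^sub>c = A\<close> and
  \<open>Q\<^sub>d = B\<close>, because \<open>A \<ge> 0\<close> and \<open>0 \<le> B \<le> I\<close> (\<open>lyapunov_inequalities_identity\<close>). For this choice,
  \<open>\<Phi>\<close> in the definition of observability is the \<open>\<Phi>\<close> of persistent excitation, and the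
  observability form at \<open>x\<close> is the dissipation \<open>W = \<integral> \<zeta> \<bullet> \<Phi> \<zeta>\<close> along the solution \<open>\<zeta>\<close> that starts at
  \<open>x\<close>, whereas excitation bounds \<open>\<integral> x \<bullet> \<Phi> x\<close> from below, with \<open>x\<close> frozen.

  The two are comparable because a solution that dissipates little does not move: its speed, and
  the size of its jumps, is \<open>|\<Phi> \<zeta>|\<close>, and \<open>|\<Phi> \<zeta>|\<^sup>2 \<le> c (\<zeta> \<bullet> \<Phi> \<zeta>)\<close> for \<open>\<Phi> \<ge> 0\<close> with \<open>|\<Phi>| \<le> c\<close>
  (\<open>psd_norm_sq_le\<close>). So if \<open>W\<close> were small relative to \<open>|x|\<^sup>2\<close>, then \<open>\<zeta>\<close> would stay close to \<open>x\<close>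
  throughout the window, and \<open>\<integral> x \<bullet> \<Phi> x\<close> would be small as well. Windows have length at most
  \<open>K + 1\<close> (\<open>shortest_window_length_le\<close>), which makes the resulting lower bound on \<open>W\<close> uniform
  (\<open>excitation_imp_observability\<close>).

  This argument needs \<open>\<Phi> = B\<close> at each jump of the window. That fails at a jump that leaves the
  interior of a flow interval, which happens in time domains with two branches. There the
  window has to be chosen differently, with a larger \<open>K\<close> (\<open>windows_without_branch_jumps\<close>). The
  transition matrix exists because \<open>A\<close> is continuous along each flow interval
  (\<open>linear_ode_solution_exists\<close>, \<open>transition_matrix_exists\<close>).\<close>

section \<open>Linear differential equations\<close>

text \<open>Integrating the bound on one Picard term gives the bound on the next one, so that the terms
  are dominated by an exponential series.\<close>

lemma picard_bound_has_integral:
  fixes a c N t :: real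
  assumes "a \<le> t"
  shows "((\<lambda>s. c * (N * (c * (s - a)) ^ n / fact n)) has_integral
    N * (c * (t - a)) ^ Suc n / fact (Suc n)) {a..t}"
proof -
  have "((\<lambda>s. N * (c * (s - a)) ^ Suc n / fact (Suc n)) has_vector_derivative
      c * (N * (c * (s - a)) ^ n / fact n)) (at s within {a..t})" for s
  proof -
    have "((\<lambda>s. N * (c * (s - a)) ^ Suc n / fact (Suc n)) has_real_derivative
        N * (real (Suc n) * (c * (s - a)) ^ n * c) / fact (Suc n)) (at s within {a..t})"
    proof -
      have "((\<lambda>s. c * (s - a)) has_real_derivative c) (at s within {a..t})"
        by (auto intro!: derivative_eq_intros)
      from DERIV_cdivide[OF DERIV_cmult[OF DERIV_power[OF this, of "Suc n"], of N], of "fact (Suc n)"]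
      show ?thesis by (rule DERIV_cong) simp
    qed
    moreover have "N * (real (Suc n) * (c * (s - a)) ^ n * c) / fact (Suc n)
        = c * (N * (c * (s - a)) ^ n / fact n)"
      by (simp add: fact_Suc field_simps del: of_nat_Suc)
    ultimately show ?thesis
      unfolding has_real_derivative_iff_has_vector_derivative by metis
  qed
  from fundamental_theorem_of_calculus[OF assms this] show ?thesis by simp
qed

text \<open>The solution is the sum of the Picard terms \<open>X n\<close>, which converges uniformly on every
  \<open>{a..b}\<close> with \<open>b\<close> in \<open>S\<close>. The one series is summed at every point of \<open>S\<close>, so that unbounded
  and half-open intervals need no patching of local solutions. A general bilinear product covers
  the matrix equation \<open>X' = F X\<close>.\<close>

lemma linear_ode_solution_exists:
  fixes prod :: "'b::real_normed_vector \<Rightarrow> 'a::banach \<Rightarrow> 'a" and F :: "real \<Rightarrow> 'b"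
  assumes bil: "bounded_bilinear prod"
    and S: "is_interval S" "S \<subseteq> {a..}" "a \<in> S"
    and F: "\<And>b. b \<in> S \<Longrightarrow> continuous_on {a..b} F"
  shows "\<exists>X. X a = x0 \<and> (\<forall>t\<in>S. (X has_vector_derivative prod (F t) (X t)) (at t within S))"
proof -
  interpret bounded_bilinear prod by (rule bil)
  define X where "X = rec_nat (\<lambda>_. x0) (\<lambda>n Xn t. integral {a..t} (\<lambda>s. prod (F s) (Xn s)))"
  have X0: "X 0 = (\<lambda>_. x0)" and XS: "X (Suc n) = (\<lambda>t. integral {a..t} (\<lambda>s. prod (F s) (X n s)))" for n
    by (simp_all add: X_def)
  define G where "G t = (\<Sum>n. X n t)" for t
  have on_compact: "\<forall>t\<in>{a..b}. summable (\<lambda>n. X n t) \<and>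
      (G has_vector_derivative prod (F t) (G t)) (at t within {a..b})" if b: "b \<in> S" for b
  proof -
    have ab: "a \<le> b" using S b by auto
    have contF: "continuous_on {a..b} F" by (rule F[OF b])
    have contX: "continuous_on {a..b} (X n)" for n
    proof (induction n)
      case (Suc n)
      show ?case unfolding XS
        by (intro indefinite_integral_continuous_1 integrable_continuous_real continuous_on contF Suc)
    qed (simp add: X0)
    have contP: "continuous_on {a..b} (\<lambda>s. prod (F s) (X n s))" for n
      by (intro continuous_on contF contX)
    have derX: "(X (Suc n) has_vector_derivative prod (F t) (X n t)) (at t within {a..b})"
      if "t \<in> {a..b}" for n t
      unfolding XS by (rule integral_has_vector_derivative[OF contP that])
    obtain CF where CF: "\<And>t. t \<in> {a..b} \<Longrightarrow> norm (F t) \<le> CF"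
      using compact_imp_bounded[OF compact_continuous_image[OF contF compact_Icc]]
      unfolding bounded_iff by blast
    obtain Kp where Kp: "\<And>x y. norm (prod x y) \<le> norm x * norm y * Kp" and Kp0: "0 \<le> Kp"
      using nonneg_bounded by blast
    define c where "c = CF * Kp"
    have CF0: "0 \<le> CF" using CF[of a] ab norm_ge_zero order_trans by (metis atLeastAtMost_iff order_refl)
    have c0: "0 \<le> c" unfolding c_def using CF0 Kp0 by simp
    have Pbound: "norm (prod (F t) x) \<le> c * norm x" if "t \<in> {a..b}" for t x
    proof -
      have "norm (prod (F t) x) \<le> norm (F t) * norm x * Kp" by (rule Kp)
      also have "\<dots> \<le> CF * norm x * Kp" by (intro mult_right_mono CF that Kp0) auto
      finally show ?thesis by (simp add: c_def ac_simps)
    qed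
    have Xbound: "norm (X n t) \<le> norm x0 * (c * (t - a)) ^ n / fact n" if "t \<in> {a..b}" for n t
      using that
    proof (induction n arbitrary: t)
      case (Suc n)
      let ?g = "\<lambda>s. c * (norm x0 * (c * (s - a)) ^ n / fact n)"
      note hi = picard_bound_has_integral[of a t c "norm x0" n]
      have "norm (integral {a..t} (\<lambda>s. prod (F s) (X n s))) \<le> integral {a..t} ?g"
      proof (rule integral_norm_bound_integral)
        show "(\<lambda>s. prod (F s) (X n s)) integrable_on {a..t}"
          using contP[of n] Suc.prems by (intro integrable_continuous_real)
            (auto intro: continuous_on_subset)
        show "?g integrable_on {a..t}" using hi Suc.prems by (auto simp: integrable_on_def)
        show "norm (prod (F s) (X n s)) \<le> ?g s" if "s \<in> {a..t}" for s
        proof -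
          have "s \<in> {a..b}" using that Suc.prems by auto
          then show ?thesis
            by (meson Pbound Suc.IH c0 mult_left_mono order_trans)
        qed
      qed
      also have "integral {a..t} ?g = norm x0 * (c * (t - a)) ^ Suc n / fact (Suc n)"
        using hi Suc.prems by (intro integral_unique) auto
      finally show ?case by (simp add: XS)
    qed (simp add: X0)
    define m where "m n = norm x0 * (c * (b - a)) ^ n / fact n" for n
    have mono_m: "norm (X n t) \<le> m n" if "t \<in> {a..b}" for n t
    proof -
      have "(c * (t - a)) ^ n \<le> (c * (b - a)) ^ n"
        using that c0 by (intro power_mono mult_left_mono) auto
      then have "norm x0 * (c * (t - a)) ^ n / fact n \<le> m n"
        unfolding m_def by (intro divide_right_mono mult_left_mono) auto
      with Xbound[OF that, of n] show ?thesis by simp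
    qed
    have sm: "summable m"
      using summable_mult[OF summable_exp[of "c * (b - a)"], of "norm x0"]
      unfolding m_def by (simp add: divide_inverse ac_simps)
    have sumX: "summable (\<lambda>n. X n t)" if "t \<in> {a..b}" for t
      using mono_m[OF that] by (intro summable_comparison_test'[OF sm])
    \<comment> \<open>\<open>d n\<close> is the derivative of the term \<open>X n\<close>; the derivatives sum uniformly to \<open>F G\<close>.\<close>
    define d where "d n t = (case n of 0 \<Rightarrow> 0 | Suc k \<Rightarrow> prod (F t) (X k t))" for n t
    have d_simps: "d 0 t = 0" "d (Suc k) t = prod (F t) (X k t)" for k t by (simp_all add: d_def)
    have d_bound: "norm (d n t) \<le> (case n of 0 \<Rightarrow> 0 | Suc k \<Rightarrow> c * m k)" if "t \<in> {a..b}" for n t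
    proof (cases n)
      case (Suc k)
      have "norm (prod (F t) (X k t)) \<le> c * m k"
        by (meson Pbound mono_m c0 mult_left_mono order_trans that)
      then show ?thesis by (simp add: Suc d_simps)
    qed (simp add: d_simps)
    have "summable (\<lambda>n. case n of 0 \<Rightarrow> 0 | Suc k \<Rightarrow> c * m k)"
      by (subst summable_Suc_iff[symmetric]) (simp add: sm summable_mult)
    then have unif: "uniform_limit {a..b} (\<lambda>n t. \<Sum>i<n. d i t) (\<lambda>t. \<Sum>i. d i t) sequentially"
      by (intro Weierstrass_m_test[OF d_bound])
    have d_suminf: "(\<Sum>i. d i t) = prod (F t) (G t)" if "t \<in> {a..b}" for t
    proof -
      have s: "(\<lambda>k. prod (F t) (X k t)) sums prod (F t) (G t)"
        unfolding G_def
        by (intro bounded_linear.sums[OF bounded_linear_right] summable_sums sumX that)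
      then have "(\<lambda>k. d (Suc k) t) sums prod (F t) (G t)" by (simp add: d_simps)
      then have "(\<lambda>k. d k t) sums (prod (F t) (G t) + d 0 t)" by (rule sums_Suc)
      then show ?thesis by (simp add: d_simps sums_iff)
    qed
    have "\<exists>g. \<forall>t\<in>{a..b}. (\<lambda>n. X n t) sums g t \<and>
        (g has_derivative (\<lambda>h. h *\<^sub>R (\<Sum>i. d i t))) (at t within {a..b})"
    proof (rule has_derivative_series[where f' = "\<lambda>n t h. h *\<^sub>R d n t"])
      show "convex {a..b}" by simp
      show "a \<in> {a..b}" using ab by simp
      then show "(\<lambda>n. X n a) sums (\<Sum>n. X n a)" by (intro summable_sums sumX)
      show "(X n has_derivative (\<lambda>h. h *\<^sub>R d n t)) (at t within {a..b})" if "t \<in> {a..b}" for n t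
        using derX[OF that] by (cases n) (simp_all add: d_simps X0 has_vector_derivative_def)
      show "\<forall>\<^sub>F n in sequentially. \<forall>t\<in>{a..b}. \<forall>h.
          norm ((\<Sum>i<n. h *\<^sub>R d i t) - h *\<^sub>R (\<Sum>i. d i t)) \<le> e * norm h" if "0 < e" for e
        using uniform_limitD[OF unif that]
      proof (rule eventually_mono, intro ballI allI)
        fix n t h assume u: "\<forall>t\<in>{a..b}. dist (\<Sum>i<n. d i t) (\<Sum>i. d i t) < e" and t: "t \<in> {a..b}"
        have "norm ((\<Sum>i<n. h *\<^sub>R d i t) - h *\<^sub>R (\<Sum>i. d i t))
            = norm h * dist (\<Sum>i<n. d i t) (\<Sum>i. d i t)"
          by (simp add: dist_norm flip: scaleR_sum_right scaleR_diff_right)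
        also have "\<dots> \<le> norm h * e" using u t by (intro mult_left_mono) (auto intro: less_imp_le)
        finally show "norm ((\<Sum>i<n. h *\<^sub>R d i t) - h *\<^sub>R (\<Sum>i. d i t)) \<le> e * norm h"
          by (simp add: ac_simps)
      qed
    qed
    then obtain g where g: "\<And>t. t \<in> {a..b} \<Longrightarrow> (\<lambda>n. X n t) sums g t"
      "\<And>t. t \<in> {a..b} \<Longrightarrow> (g has_derivative (\<lambda>h. h *\<^sub>R (\<Sum>i. d i t))) (at t within {a..b})"
      by blast
    have gG: "g t = G t" if "t \<in> {a..b}" for t using g(1)[OF that] by (simp add: G_def sums_iff)
    show ?thesis
    proof (intro ballI conjI)
      fix t assume t: "t \<in> {a..b}"
      show "summable (\<lambda>n. X n t)" by (rule sumX[OF t])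
      have "(g has_vector_derivative prod (F t) (G t)) (at t within {a..b})"
        using g(2)[OF t] by (simp add: has_vector_derivative_def d_suminf[OF t])
      then show "(G has_vector_derivative prod (F t) (G t)) (at t within {a..b})"
        by (rule has_vector_derivative_transform[OF t gG[symmetric], rotated])
    qed
  qed
  have Xa: "X (Suc n) a = 0" for n by (simp add: XS)
  have "(\<Sum>n. X n a) = (\<Sum>n<1. X n a)"
    by (intro suminf_finite) (auto simp: Xa gr0_conv_Suc)
  then have "G a = x0" by (simp add: G_def X0)
  moreover have Icc_sub: "{a..u} \<subseteq> S" if "u \<in> S" for u
    using mem_is_interval_1_I[OF S(1,3) that] by auto
  moreover have "(G has_vector_derivative prod (F t) (G t)) (at t within S)" if t: "t \<in> S" for t
  proof -
    \<comment> \<open>Near \<open>t\<close> the set \<open>S\<close> agrees with a compact interval: one reaching beyond \<open>t\<close>, or \<open>S\<close> itself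
      when \<open>t\<close> is its last point.\<close>
    have "\<exists>b\<in>S. t \<in> {a..b} \<and> at t within {a..b} = at t within S"
    proof (cases "\<exists>b\<in>S. t < b")
      case True
      then obtain b where b: "b \<in> S" "t < b" by blast
      have "{a..b} \<subseteq> S" by (rule Icc_sub[OF b(1)])
      moreover have "S \<inter> {..<b} \<subseteq> {a..b}" using S by auto
      ultimately have "at t within {a..b} = at t within S"
        using b t by (intro at_within_nhd[where S = "{..<b}"]) auto
      then show ?thesis using b t S(2) by (intro bexI[of _ b]) auto
    next
      case False
      then have "{a..t} = S" using S(2) Icc_sub[OF t] by (force simp: not_less)
      then show ?thesis using t S by auto
    qed
    with on_compact show ?thesis by metis
  qed
  ultimately show ?thesis by blast
qed

section \<open>Positive semidefinite matrices\<close>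

lemma psd_symmetric_move:
  fixes X :: "real^'n^'n"
  assumes "transpose X = X"
  shows "x \<bullet> (X *v y) = (X *v x) \<bullet> y"
  by (metis assms dot_lmul_matrix vector_transpose_matrix)

lemma norm_mult_le_mat_norm:
  assumes "mat_norm X \<le> c"
  shows "norm (X *v x) \<le> c * norm x"
proof -
  have "norm (X *v x) \<le> mat_norm X * norm x"
    unfolding mat_norm_def by (rule onorm) simp
  also have "\<dots> \<le> c * norm x" by (rule mult_right_mono[OF assms norm_ge_zero])
  finally show ?thesis .
qed

text \<open>Cauchy-Schwarz for the form of \<open>X\<close>, applied to \<open>x\<close> and \<open>X x\<close>: the form is nonnegative at
  \<open>x - X x / c\<close>.\<close>

lemma psd_norm_sq_le:
  fixes X :: "real^'n^'n"
  assumes "psd X" "mat_norm X \<le> c" "0 < c"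
  shows "(norm (X *v x))\<^sup>2 \<le> c * (x \<bullet> (X *v x))"
proof -
  define y where "y = X *v x"
  have sym: "transpose X = X" using assms by (simp add: psd_def)
  define n where "n = (norm y)\<^sup>2"
  have xy: "x \<bullet> (X *v y) = n"
    using psd_symmetric_move[OF sym, of x y] by (simp add: y_def n_def dot_square_norm)
  have yy: "y \<bullet> (X *v y) \<le> c * n"
  proof -
    have "y \<bullet> (X *v y) \<le> norm y * norm (X *v y)" by (rule norm_cauchy_schwarz)
    also have "\<dots> \<le> norm y * (c * norm y)"
      by (intro mult_left_mono norm_mult_le_mat_norm assms(2) norm_ge_zero)
    finally show ?thesis by (simp add: n_def power2_eq_square ac_simps)
  qed
  have "0 \<le> (x - (1 / c) *\<^sub>R y) \<bullet> (X *v (x - (1 / c) *\<^sub>R y))"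
    using assms by (simp add: psd_def)
  also have "\<dots> = x \<bullet> y - (2 / c) * n + (1 / c)\<^sup>2 * (y \<bullet> (X *v y))"
  proof -
    have "y \<bullet> y = n" by (simp add: n_def dot_square_norm)
    then show ?thesis
      by (simp add: matrix_vector_mult_diff_distrib matrix_vector_mult_scaleR inner_diff_left
          inner_diff_right xy y_def[symmetric] power2_eq_square algebra_simps)
  qed
  also have "\<dots> \<le> x \<bullet> y - (2 / c) * n + (1 / c)\<^sup>2 * (c * n)"
    using yy by (simp add: mult_left_mono)
  also have "\<dots> = x \<bullet> y - n / c"
    using assms(3) by (simp add: power2_eq_square field_simps)
  finally show ?thesis using assms(3) by (simp add: n_def y_def field_simps)
qed

text \<open>The speed \<open>|X x|\<close> of a solution is controlled linearly by the dissipation \<open>x \<bullet> X x\<close>. This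
  form integrates over a window directly, where the quadratic bound would call for Cauchy-Schwarz
  for integrals.\<close>

lemma psd_norm_le_young:
  fixes X :: "real^'n^'n"
  assumes "psd X" "mat_norm X \<le> c" "0 < c" "0 < \<eta>"
  shows "norm (X *v x) \<le> \<eta> / 2 + c / (2 * \<eta>) * (x \<bullet> (X *v x))"
proof -
  have "2 * \<eta> * norm (X *v x) \<le> \<eta>\<^sup>2 + (norm (X *v x))\<^sup>2"
    by (metis sum_squares_bound mult.commute mult.left_commute)
  also have "\<dots> \<le> \<eta>\<^sup>2 + c * (x \<bullet> (X *v x))"
    using psd_norm_sq_le[OF assms(1-3)] by simp
  finally show ?thesis using assms(4) by (simp add: field_simps power2_eq_square)
qed

text \<open>The parallelogram inequality for the form of \<open>X\<close>, which moves the excitation from a frozen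
  vector \<open>x\<close> to a point \<open>y\<close> of the solution starting at \<open>x\<close>.\<close>

lemma psd_form_le_twice:
  fixes X :: "real^'n^'n"
  assumes "psd X" "mat_norm X \<le> c"
  shows "x \<bullet> (X *v x) \<le> 2 * (y \<bullet> (X *v y)) + 2 * c * (norm (y - x))\<^sup>2"
proof -
  have sym: "transpose X = X" using assms by (simp add: psd_def)
  have "0 \<le> (x - 2 *\<^sub>R y) \<bullet> (X *v (x - 2 *\<^sub>R y))"
    using assms by (simp add: psd_def)
  also have "\<dots> = 2 * (y \<bullet> (X *v y)) + 2 * ((y - x) \<bullet> (X *v (y - x))) - x \<bullet> (X *v x)"
    using psd_symmetric_move[OF sym, of x y]
    by (simp add: matrix_vector_mult_diff_distrib matrix_vector_mult_scaleR inner_diff_left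
        inner_diff_right inner_commute algebra_simps)
  finally have "x \<bullet> (X *v x) \<le> 2 * (y \<bullet> (X *v y)) + 2 * ((y - x) \<bullet> (X *v (y - x)))" by simp
  moreover have "(y - x) \<bullet> (X *v (y - x)) \<le> c * (norm (y - x))\<^sup>2"
  proof -
    have "(y - x) \<bullet> (X *v (y - x)) \<le> norm (y - x) * norm (X *v (y - x))"
      by (rule norm_cauchy_schwarz)
    also have "\<dots> \<le> norm (y - x) * (c * norm (y - x))"
      by (intro mult_left_mono norm_mult_le_mat_norm assms(2) norm_ge_zero)
    finally show ?thesis by (simp add: power2_eq_square ac_simps)
  qed
  ultimately show ?thesis by linarith
qed

lemma psd_le_iff:
  fixes X Y :: "real^'n^'n"
  shows "X \<preceq> Y \<longleftrightarrow> transpose (Y - X) = Y - X \<and> (\<forall>x. x \<bullet> (X *v x) \<le> x \<bullet> (Y *v x))"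
  by (simp add: psd_le_def psd_def matrix_vector_mult_diff_rdistrib inner_diff_right)

lemma transpose_diff: "transpose (X - Y) = transpose X - transpose (Y :: real^'n^'m)"
  by (simp add: transpose_def vec_eq_iff)

text \<open>\<open>X\<^sup>2 \<le> X\<close> for \<open>0 \<le> X \<le> I\<close>, since \<open>x \<bullet> X\<^sup>2 x = |X x|\<^sup>2 \<le> x \<bullet> X x\<close>; this is the jump
  inequality of the Lyapunov function \<open>|\<zeta>|\<^sup>2\<close>.\<close>

lemma psd_diff_square:
  fixes X :: "real^'n^'n"
  assumes "psd X" "mat_norm X \<le> 1"
  shows "psd (X - X ** X)"
proof -
  have sym: "transpose X = X" using assms by (simp add: psd_def)
  have "x \<bullet> (X *v (X *v x)) \<le> x \<bullet> (X *v x)" for x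
    using psd_norm_sq_le[OF assms, of x] psd_symmetric_move[OF sym, of x "X *v x"]
    by (simp add: dot_square_norm)
  then show ?thesis
    by (simp add: psd_def sym transpose_diff matrix_transpose_mul matrix_vector_mult_diff_rdistrib
        inner_diff_right flip: matrix_vector_mul_assoc)
qed

lemma bounded_bilinear_matrix_mult:
  "bounded_bilinear ((**) :: real^'n^'m \<Rightarrow> real^'p^'n \<Rightarrow> real^'p^'m)"
  unfolding bilinear_conv_bounded_bilinear[symmetric]
  by (auto simp: bilinear_def matrix_matrix_mult_def vec_eq_iff sum.distrib sum_distrib_left
      algebra_simps intro!: linearI)

lemma bounded_linear_transpose: "bounded_linear (transpose :: real^'n^'m \<Rightarrow> real^'m^'n)"
  by (rule linear_conv_bounded_linear[THEN iffD1], rule linearI)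
    (simp_all add: transpose_scalar, simp add: transpose_def vec_eq_iff)

lemma bounded_linear_mult_vec: "bounded_linear (\<lambda>X. X *v (x :: real^'n) :: real^'m)"
  by (rule linear_conv_bounded_linear[THEN iffD1], rule linearI)
    (simp_all add: matrix_vector_mult_add_rdistrib scaleR_matrix_vector_assoc)

lemma bounded_linear_quadratic_form: "bounded_linear (\<lambda>X :: real^'n^'n. x \<bullet> (X *v x))"
  by (rule bounded_linear_compose[OF bounded_linear_inner_right bounded_linear_mult_vec])

lemma transpose_conj:
  "transpose (transpose M ** X ** M) = transpose M ** transpose X ** (M :: real^'n^'n)"
  by (simp add: matrix_transpose_mul matrix_mul_assoc)

lemma quadratic_form_conj:
  "x \<bullet> ((transpose M ** X ** M) *v x) = (M *v x) \<bullet> (X *v (M *v (x :: real^'n)))"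
  by (metis dot_lmul_matrix matrix_vector_mul_assoc vector_transpose_matrix transpose_transpose)

section \<open>Hybrid time domains\<close>

text \<open>What a point \<open>(T, J)\<close> of a hybrid time domain says about its past: up to time \<open>T\<close>, the flow
  interval of each \<open>i \<le> J\<close> is exactly \<open>{\<tau> i..\<tau> (Suc i)}\<close>.\<close>

definition breakpoints :: "(real \<times> nat) set \<Rightarrow> real \<Rightarrow> nat \<Rightarrow> (nat \<Rightarrow> real) \<Rightarrow> bool" where
  "breakpoints D T J \<tau> \<longleftrightarrow> (\<forall>i\<le>J. \<tau> i \<le> \<tau> (Suc i)) \<and> \<tau> (Suc J) = T \<and>
     (\<forall>i\<le>J. \<forall>t. \<tau> i \<le> t \<longrightarrow> t \<le> \<tau> (Suc i) \<longrightarrow> (t, i) \<in> D) \<and>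
     (\<forall>i\<le>J. \<forall>t\<le>T. (t, i) \<in> D \<longrightarrow> \<tau> i \<le> t \<and> t \<le> \<tau> (Suc i))"

lemma breakpointsD:
  assumes "breakpoints D T J \<tau>"
  shows "\<And>i. i \<le> J \<Longrightarrow> \<tau> i \<le> \<tau> (Suc i)" "\<tau> (Suc J) = T"
    "\<And>i t. i \<le> J \<Longrightarrow> \<tau> i \<le> t \<Longrightarrow> t \<le> \<tau> (Suc i) \<Longrightarrow> (t, i) \<in> D"
    "\<And>i t. i \<le> J \<Longrightarrow> t \<le> T \<Longrightarrow> (t, i) \<in> D \<Longrightarrow> \<tau> i \<le> t \<and> t \<le> \<tau> (Suc i)"
  using assms unfolding breakpoints_def by blast+

lemma htd_breakpoints:
  assumes "hybrid_time_domain D" "(T, J) \<in> D"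
  shows "\<exists>\<tau>. breakpoints D T J \<tau>"
proof -
  have sub: "D \<subseteq> {0..} \<times> UNIV" and "\<forall>(T, J)\<in>D. \<exists>\<tau>. \<tau> 0 = 0 \<and>
      (\<forall>i\<le>J. \<tau> i \<le> \<tau> (Suc i)) \<and> \<tau> (Suc J) = T \<and> D \<inter> ({0..T} \<times> {0..J}) = htd_segment 0 J \<tau>"
    using assms(1) unfolding hybrid_time_domain_def by simp_all
  from bspec[OF this(2) assms(2)] obtain \<tau> where \<tau>: "\<forall>i\<le>J. \<tau> i \<le> \<tau> (Suc i)" "\<tau> (Suc J) = T"
    and D: "D \<inter> ({0..T} \<times> {0..J}) = htd_segment 0 J \<tau>"
    by (auto simp only: prod.case)
  have nonneg: "0 \<le> t" if "(t, i) \<in> D" for t i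
    using sub that by auto
  have "(t, i) \<in> D" if "i \<le> J" "\<tau> i \<le> t" "t \<le> \<tau> (Suc i)" for i t
  proof -
    have "(t, i) \<in> htd_segment 0 J \<tau>" using that by (auto simp: htd_segment_def)
    with D show ?thesis by blast
  qed
  moreover have "\<tau> i \<le> t \<and> t \<le> \<tau> (Suc i)" if "i \<le> J" "t \<le> T" "(t, i) \<in> D" for i t
  proof -
    have "(t, i) \<in> htd_segment 0 J \<tau>"
      unfolding D[symmetric] using that nonneg[OF that(3)] by simp
    then show ?thesis by (auto simp: htd_segment_def)
  qed
  ultimately show ?thesis using \<tau> unfolding breakpoints_def by blast
qed

lemma breakpoints_mono:
  fixes \<tau> :: "nat \<Rightarrow> real"
  assumes "\<And>k. m \<le> k \<Longrightarrow> k < n \<Longrightarrow> \<tau> k \<le> \<tau> (Suc k)" "m \<le> i" "i \<le> j" "j \<le> n"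
  shows "\<tau> i \<le> \<tau> j"
  using assms(3,4)
proof (induction j rule: dec_induct)
  case (step k)
  then show ?case using assms(1)[of k] assms(2) by fastforce
qed simp

lemma flow_interval_is_interval:
  assumes "hybrid_time_domain D"
  shows "is_interval (flow_interval D j)"
  unfolding is_interval_1
proof (intro ballI allI impI)
  fix s u t assume s: "s \<in> flow_interval D j" and u: "u \<in> flow_interval D j" and t: "s \<le> t \<and> t \<le> u"
  have "(s, j) \<in> D" "(u, j) \<in> D" using s u by (simp_all add: flow_interval_def)
  obtain \<tau> where \<tau>: "breakpoints D u j \<tau>"
    using htd_breakpoints[OF assms \<open>(u, j) \<in> D\<close>] by blast
  have "\<tau> j \<le> t" using breakpointsD(4)[OF \<tau>, of j s] t \<open>(s, j) \<in> D\<close> by auto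
  then have "(t, j) \<in> D" using breakpointsD(3)[OF \<tau>, of j t] breakpointsD(2)[OF \<tau>] t by auto
  then show "t \<in> flow_interval D j" by (simp add: flow_interval_def)
qed

lemma jump_time_le_later_flow:
  assumes "hybrid_time_domain D" "(t, j) \<in> D" "(t, Suc j) \<in> D" "(s, Suc j) \<in> D"
  shows "t \<le> s"
proof (rule ccontr)
  assume "\<not> t \<le> s"
  obtain \<tau> where \<tau>: "breakpoints D t (Suc j) \<tau>"
    using htd_breakpoints[OF assms(1,3)] by blast
  have "t \<le> \<tau> (Suc j)" using breakpointsD(4)[OF \<tau>, of j t] assms(2) by simp
  moreover have "\<tau> (Suc j) \<le> s" using breakpointsD(4)[OF \<tau>, of "Suc j" s] assms(4) \<open>\<not> t \<le> s\<close> by simp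
  ultimately show False using \<open>\<not> t \<le> s\<close> by simp
qed

text \<open>A flow interval that is reached after \<open>(t\<^sub>0, j\<^sub>0)\<close> is entered by a jump, at which a solution
  can be restarted.\<close>

lemma jump_into_flow_interval:
  assumes dom: "hybrid_time_domain D" and 0: "(t\<^sub>0, j\<^sub>0) \<in> D" and s: "(s, Suc j) \<in> D"
    and le: "t\<^sub>0 \<le> s" "j\<^sub>0 \<le> j"
  shows "\<exists>t. (t, j) \<in> D \<and> (t, Suc j) \<in> D \<and> t\<^sub>0 \<le> t"
proof -
  obtain \<tau> where \<tau>: "breakpoints D s (Suc j) \<tau>"
    using htd_breakpoints[OF dom s] by blast
  note mono = breakpointsD(1)[OF \<tau>] and inD = breakpointsD(3)[OF \<tau>] and D = breakpointsD(4)[OF \<tau>]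
  have "t\<^sub>0 \<le> \<tau> (Suc j\<^sub>0)" using D[of j\<^sub>0 t\<^sub>0] 0 le by auto
  also have "\<tau> (Suc j\<^sub>0) \<le> \<tau> (Suc j)"
    by (rule breakpoints_mono[where m = 0 and n = "Suc (Suc j)"]) (use mono le in auto)
  finally show ?thesis using inD[of j "\<tau> (Suc j)"] inD[of "Suc j" "\<tau> (Suc j)"] mono by auto
qed

section \<open>Hybrid arcs and the transition matrix\<close>

lemma abs_continuous_imp_continuous_on:
  assumes "abs_continuous_on_interval a b f"
  shows "continuous_on {a..b} f"
  unfolding continuous_on_iff
proof (intro ballI allI impI)
  fix x e :: real assume x: "x \<in> {a..b}" and e: "0 < e"
  obtain d where d: "0 < d" and D: "\<And>p S. p division_of S \<Longrightarrow> S \<subseteq> {a..b} \<Longrightarrow>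
      (\<Sum>k\<in>p. Sup k - Inf k) < d \<Longrightarrow> (\<Sum>k\<in>p. norm (f (Sup k) - f (Inf k))) < e"
    using assms e unfolding abs_continuous_on_interval_def by metis
  have step: "norm (f v - f u) < e" if "u \<in> {a..b}" "v \<in> {a..b}" "u \<le> v" "v - u < d" for u v
  proof -
    have "{{u..v}} division_of {u..v}"
      using division_of_self[of u v] that by (simp add: cbox_interval)
    from D[OF this] that show ?thesis by auto
  qed
  show "\<exists>d>0. \<forall>y\<in>{a..b}. dist y x < d \<longrightarrow> dist (f y) (f x) < e"
  proof (intro exI[of _ d] conjI d ballI impI)
    fix y assume y: "y \<in> {a..b}" "dist y x < d"
    show "dist (f y) (f x) < e"
    proof (cases "x \<le> y")
      case True
      with step[OF x y(1)] y show ?thesis by (auto simp: dist_norm)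
    next
      case False
      with step[OF y(1) x] y show ?thesis by (auto simp: dist_norm norm_minus_commute)
    qed
  qed
qed

lemma hybrid_arc_continuous_on:
  assumes "hybrid_arc D X" "{a..b} \<subseteq> flow_interval D j"
  shows "continuous_on {a..b} (\<lambda>t. X t j)"
  using assms by (auto simp: hybrid_arc_def intro: abs_continuous_imp_continuous_on)

lemma hybrid_arc_const:
  assumes "hybrid_time_domain D"
  shows "hybrid_arc D (\<lambda>_ _. C)"
  using assms by (auto simp: hybrid_arc_def abs_continuous_on_interval_def intro: exI[of _ 1])

text \<open>From each \<open>(t\<^sub>0, j\<^sub>0)\<close> the solution is constructed one flow interval at a time. The flow interval
  of \<open>Suc j\<close> starts at the only time of a jump into it, so the jump map there provides the initial value of
  the next flow.\<close>

lemma transition_matrix_exists: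
  fixes A B :: "real \<Rightarrow> nat \<Rightarrow> real^'n^'n"
  assumes dom: "hybrid_time_domain D" and arcA: "hybrid_arc D A"
  shows "\<exists>M. transition_matrix D A B M"
proof -
  have flow: "\<exists>X. X a = X\<^sub>0 \<and> (\<forall>t. (t, j) \<in> D \<longrightarrow> t\<^sub>0 \<le> t \<longrightarrow>
      (X has_vector_derivative - (A t j ** X t)) (at t within flow_interval D j \<inter> {t\<^sub>0..}))"
    if a: "(a, j) \<in> D" "t\<^sub>0 \<le> a" and first: "\<And>s. (s, j) \<in> D \<Longrightarrow> t\<^sub>0 \<le> s \<Longrightarrow> a \<le> s"
    for a t\<^sub>0 :: real and j :: nat and X\<^sub>0 :: "real^'n^'n"
  proof -
    let ?S = "flow_interval D j \<inter> {t\<^sub>0..}"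
    have int: "is_interval ?S"
      by (intro is_interval_Int flow_interval_is_interval dom is_interval_ci)
    have aS: "a \<in> ?S" "?S \<subseteq> {a..}" using a first by (auto simp: flow_interval_def)
    have "continuous_on {a..b} (\<lambda>t. - A t j)" if "b \<in> ?S" for b
    proof (intro continuous_on_minus, rule hybrid_arc_continuous_on[OF arcA])
      show "{a..b} \<subseteq> flow_interval D j"
        using mem_is_interval_1_I[OF int aS(1) that] by auto
    qed
    from linear_ode_solution_exists[OF bounded_bilinear_matrix_mult int aS(2,1) this, where ?x0.0 = X\<^sub>0]
    show ?thesis
      by (simp add: flow_interval_def Ball_def imp_conjL bounded_bilinear.minus_left[OF bounded_bilinear_matrix_mult])
  qed
  have sol: "\<exists>Y. \<forall>n.
      ((n = 0 \<longrightarrow> Y n t\<^sub>0 = mat 1) \<and>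
        (\<forall>t. (t, j\<^sub>0 + n) \<in> D \<longrightarrow> t\<^sub>0 \<le> t \<longrightarrow>
          (Y n has_vector_derivative - (A t (j\<^sub>0 + n) ** Y n t))
            (at t within flow_interval D (j\<^sub>0 + n) \<inter> {t\<^sub>0..}))) \<and>
      (\<forall>t. (t, j\<^sub>0 + n) \<in> D \<longrightarrow> (t, Suc (j\<^sub>0 + n)) \<in> D \<longrightarrow> t\<^sub>0 \<le> t \<longrightarrow>
          Y (Suc n) t = (mat 1 - B t (j\<^sub>0 + n)) ** Y n t)"
    if 0: "(t\<^sub>0, j\<^sub>0) \<in> D" for t\<^sub>0 j\<^sub>0
  proof (rule dependent_nat_choice, goal_cases)
    case 1
    from flow[of t\<^sub>0 j\<^sub>0 t\<^sub>0 "mat 1"] 0 show ?case by auto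
  next
    case (2 X n)
    show ?case
    proof (cases "\<exists>a. (a, j\<^sub>0 + n) \<in> D \<and> (a, Suc (j\<^sub>0 + n)) \<in> D \<and> t\<^sub>0 \<le> a")
      case True
      then obtain a where a: "(a, j\<^sub>0 + n) \<in> D" "(a, Suc (j\<^sub>0 + n)) \<in> D" "t\<^sub>0 \<le> a" by blast
      have first: "a \<le> s" if "(s, Suc (j\<^sub>0 + n)) \<in> D" for s
        by (rule jump_time_le_later_flow[OF dom a(1,2) that])
      obtain Y where Y: "Y a = (mat 1 - B a (j\<^sub>0 + n)) ** X a"
        "\<And>t. (t, Suc (j\<^sub>0 + n)) \<in> D \<Longrightarrow> t\<^sub>0 \<le> t \<Longrightarrow>
          (Y has_vector_derivative - (A t (Suc (j\<^sub>0 + n)) ** Y t))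
            (at t within flow_interval D (Suc (j\<^sub>0 + n)) \<inter> {t\<^sub>0..})"
        using flow[OF a(2,3) first] by blast
      have "Y t = (mat 1 - B t (j\<^sub>0 + n)) ** X t"
        if "(t, j\<^sub>0 + n) \<in> D" "(t, Suc (j\<^sub>0 + n)) \<in> D" "t\<^sub>0 \<le> t" for t
      proof -
        have "t = a" using first[OF that(2)] jump_time_le_later_flow[OF dom that(1,2) a(2)] by simp
        with Y(1) show ?thesis by simp
      qed
      with Y(2) show ?thesis by (intro exI[of _ Y]) auto
    next
      case False
      then have "(s, Suc (j\<^sub>0 + n)) \<notin> D" if "t\<^sub>0 \<le> s" for s
        using jump_into_flow_interval[OF dom 0 _ that, of "j\<^sub>0 + n"] by auto
      \<comment> \<open>There is no flow left to solve, and any function will do.\<close>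
      then show ?thesis by (intro exI[of _ undefined]) auto
    qed
  qed
  \<comment> \<open>\<open>Y p n\<close> solves on the \<open>n\<close>-th flow interval counted from the initial point \<open>p\<close>.\<close>
  define Y where "Y p = (SOME Y. \<forall>n.
      ((n = 0 \<longrightarrow> Y n (fst p) = mat 1) \<and>
        (\<forall>t. (t, snd p + n) \<in> D \<longrightarrow> fst p \<le> t \<longrightarrow>
          (Y n has_vector_derivative - (A t (snd p + n) ** Y n t))
            (at t within flow_interval D (snd p + n) \<inter> {fst p..}))) \<and>
      (\<forall>t. (t, snd p + n) \<in> D \<longrightarrow> (t, Suc (snd p + n)) \<in> D \<longrightarrow> fst p \<le> t \<longrightarrow>
          Y (Suc n) t = (mat 1 - B t (snd p + n)) ** Y n t))" for p
  have Y: "(n = 0 \<longrightarrow> Y (t\<^sub>0, j\<^sub>0) n t\<^sub>0 = mat 1) \<and>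
        (\<forall>t. (t, j\<^sub>0 + n) \<in> D \<longrightarrow> t\<^sub>0 \<le> t \<longrightarrow>
          (Y (t\<^sub>0, j\<^sub>0) n has_vector_derivative - (A t (j\<^sub>0 + n) ** Y (t\<^sub>0, j\<^sub>0) n t))
            (at t within flow_interval D (j\<^sub>0 + n) \<inter> {t\<^sub>0..})) \<and>
      (\<forall>t. (t, j\<^sub>0 + n) \<in> D \<longrightarrow> (t, Suc (j\<^sub>0 + n)) \<in> D \<longrightarrow> t\<^sub>0 \<le> t \<longrightarrow>
          Y (t\<^sub>0, j\<^sub>0) (Suc n) t = (mat 1 - B t (j\<^sub>0 + n)) ** Y (t\<^sub>0, j\<^sub>0) n t)"
    if "(t\<^sub>0, j\<^sub>0) \<in> D" for t\<^sub>0 j\<^sub>0 n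
    using someI_ex[OF sol[OF that]] unfolding Y_def fst_conv snd_conv by blast
  show ?thesis
  proof (rule exI[of _ "\<lambda>(t, j) p. Y p (j - snd p) t"], unfold transition_matrix_def split_def,
      intro ballI conjI allI impI, goal_cases)
    case (1 p)
    then show ?case using Y[of "fst p" "snd p" 0] by simp
  next
    case (2 p q)
    then show ?case using Y[of "fst p" "snd p" "snd q - snd p"] by simp
  next
    case (3 p t j)
    then show ?case using Y[of "fst p" "snd p" "j - snd p"] by (simp add: Suc_diff_le)
  qed
qed

section \<open>Windows\<close>

text \<open>A longer window could be shortened without falling below \<open>K\<close>. This makes the lengths of all
  windows uniformly bounded.\<close>

lemma shortest_window_length_le:
  assumes W: "shortest_window D t j K m \<tau>" and K: "0 < K"
  shows "segment_length j m \<tau> \<le> K + 1"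
proof (rule ccontr)
  assume long: "\<not> ?thesis"
  have seg: "segment_in D t j m \<tau>" and jm: "j \<le> m" and mono: "\<And>i. i \<in> {j..m} \<Longrightarrow> \<tau> i \<le> \<tau> (Suc i)"
    and sub: "htd_segment j m \<tau> \<subseteq> D"
    using W by (auto simp: shortest_window_def segment_in_def)
  have min: "segment_length j m \<tau> \<le> segment_length j m' \<tau>'"
    if "segment_in D t j m' \<tau>'" "K \<le> segment_length j m' \<tau>'" for m' \<tau>'
    using W that unfolding shortest_window_def by blast
  show False
  proof (cases "\<tau> m < \<tau> (Suc m)")
    case True
    \<comment> \<open>stop flowing a little earlier\<close>
    define e where "e = min (\<tau> (Suc m) - \<tau> m) 1"
    define \<tau>' where "\<tau>' = \<tau>(Suc m := \<tau> (Suc m) - e)"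
    have e: "0 < e" "e \<le> 1" "e \<le> \<tau> (Suc m) - \<tau> m" using True by (auto simp: e_def)
    have len: "segment_length j m \<tau>' = segment_length j m \<tau> - e"
      using jm by (simp add: segment_length_def \<tau>'_def)
    have "htd_segment j m \<tau>' \<subseteq> htd_segment j m \<tau>"
      unfolding htd_segment_def
      using e by (intro UN_mono Sigma_mono subset_refl) (auto simp: \<tau>'_def)
    moreover have "\<tau>' i \<le> \<tau>' (Suc i)" if "i \<in> {j..m}" for i
      using mono[OF that] e that by (auto simp: \<tau>'_def)
    ultimately have "segment_in D t j m \<tau>'"
      using seg sub jm by (auto simp: segment_in_def \<tau>'_def)
    from min[OF this] len long e show False by simp
  next
    case False
    then have eq: "\<tau> (Suc m) = \<tau> m" using mono[of m] jm by auto
    show False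
    proof (cases "m = j")
      case True
      with eq long K show False by (simp add: segment_length_def)
    next
      case False
      \<comment> \<open>drop the final jump\<close>
      then obtain n where n: "m = Suc n" "j \<le> n" using jm by (cases m) auto
      have "segment_in D t j n \<tau>"
        using seg n by (auto simp: segment_in_def htd_segment_def)
      moreover have "segment_length j n \<tau> = segment_length j m \<tau> - 1"
        using eq n by (simp add: segment_length_def)
      ultimately show False using min long by fastforce
    qed
  qed
qed

lemma segment_in_domain:
  assumes "segment_in D t j m \<tau>" "i \<in> {j..m}" "s \<in> {\<tau> i..\<tau> (Suc i)}"
  shows "(s, i) \<in> D"
proof -
  have "(s, i) \<in> htd_segment j m \<tau>" using assms(2,3) by (auto simp: htd_segment_def)
  with assms(1) show ?thesis by (auto simp: segment_in_def)
qed

lemma segment_in_order: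
  assumes "segment_in D t j m \<tau>" "i \<in> {j..m}"
  shows "\<tau> i \<le> \<tau> (Suc i)" "t \<le> \<tau> i"
proof -
  have mono: "\<And>k. k \<in> {j..m} \<Longrightarrow> \<tau> k \<le> \<tau> (Suc k)" and tj: "\<tau> j = t"
    using assms(1) by (auto simp: segment_in_def)
  show "\<tau> i \<le> \<tau> (Suc i)" by (rule mono[OF assms(2)])
  have "\<tau> j \<le> \<tau> i"
    by (rule breakpoints_mono[where m = j and n = "Suc m"]) (use mono assms(2) in auto)
  then show "t \<le> \<tau> i" by (simp add: tj)
qed

lemma segment_in_flow_interval:
  assumes "segment_in D t j m \<tau>" "i \<in> {j..m}"
  shows "{\<tau> i..\<tau> (Suc i)} \<subseteq> flow_interval D i"
  using segment_in_domain[OF assms] by (auto simp: flow_interval_def)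

lemma segment_in_interior:
  assumes "segment_in D t j m \<tau>" "i \<in> {j..m}" "s \<in> {\<tau> i<..<\<tau> (Suc i)}"
  shows "s \<in> interior (flow_interval D i)"
proof -
  have "{\<tau> i<..<\<tau> (Suc i)} \<subseteq> interior (flow_interval D i)"
    by (rule interior_maximal)
      (use segment_in_flow_interval[OF assms(1,2)] in force, simp)
  with assms(3) show ?thesis by blast
qed

section \<open>Hybrid integrals\<close>

lemma hybrid_integrable_linear:
  assumes "bounded_linear f" "hybrid_integrable j m \<tau> g"
  shows "hybrid_integrable j m \<tau> (\<lambda>s i. f (g s i))"
  using assms integrable_linear[OF _ assms(1)] by (auto simp: hybrid_integrable_def o_def)

lemma hybrid_integral_linear:
  assumes "bounded_linear f" "hybrid_integrable j m \<tau> g"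
  shows "hybrid_integral j m \<tau> (\<lambda>s i. f (g s i)) = f (hybrid_integral j m \<tau> g)"
proof -
  interpret bounded_linear f by fact
  have "integral {\<tau> i..\<tau> (Suc i)} (\<lambda>s. f (g s i)) = f (integral {\<tau> i..\<tau> (Suc i)} (\<lambda>s. g s i))"
    if "i \<in> {j..m}" for i
    using integral_linear[OF _ assms(1), of "\<lambda>s. g s i"] assms(2) that
    by (auto simp: hybrid_integrable_def o_def)
  then show ?thesis by (simp add: hybrid_integral_def add sum)
qed

lemma hybrid_integral_cong:
  assumes "segment_in D t j m \<tau>" "\<And>s i. (s, i) \<in> D \<Longrightarrow> g s i = h s i"
  shows "hybrid_integral j m \<tau> g = hybrid_integral j m \<tau> h"
proof -
  have "integral {\<tau> i..\<tau> (Suc i)} (\<lambda>s. g s i) = integral {\<tau> i..\<tau> (Suc i)} (\<lambda>s. h s i)"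
    if "i \<in> {j..m}" for i
    by (rule integral_cong) (rule assms(2)[OF segment_in_domain[OF assms(1) that]])
  moreover have "g (\<tau> (Suc i)) i = h (\<tau> (Suc i)) i" if "i \<in> {j..<m}" for i
    using that segment_in_order(1)[OF assms(1), of i]
    by (intro assms(2) segment_in_domain[OF assms(1)]) auto
  ultimately show ?thesis by (simp add: hybrid_integral_def)
qed

lemma hybrid_integral_mono:
  fixes g h :: "real \<Rightarrow> nat \<Rightarrow> real"
  assumes "segment_in D t j m \<tau>" "hybrid_integrable j m \<tau> g" "hybrid_integrable j m \<tau> h"
    and "\<And>s i. (s, i) \<in> D \<Longrightarrow> g s i \<le> h s i"
  shows "hybrid_integral j m \<tau> g \<le> hybrid_integral j m \<tau> h"
  unfolding hybrid_integral_def
proof (intro add_mono sum_mono)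
  fix i assume i: "i \<in> {j..m}"
  show "integral {\<tau> i..\<tau> (Suc i)} (\<lambda>s. g s i) \<le> integral {\<tau> i..\<tau> (Suc i)} (\<lambda>s. h s i)"
    using assms(2,3) i segment_in_domain[OF assms(1) i]
    by (intro integral_le) (auto simp: hybrid_integrable_def intro!: assms(4))
next
  fix i assume "i \<in> {j..<m}"
  then show "g (\<tau> (Suc i)) i \<le> h (\<tau> (Suc i)) i"
    using segment_in_order(1)[OF assms(1), of i]
    by (intro assms(4) segment_in_domain[OF assms(1)]) auto
qed

lemma hybrid_integrable_affine:
  fixes g :: "real \<Rightarrow> nat \<Rightarrow> real"
  assumes "hybrid_integrable j m \<tau> g"
  shows "hybrid_integrable j m \<tau> (\<lambda>s i. a + b * g s i)"
  using assms by (auto simp: hybrid_integrable_def intro!: integrable_add integrable_on_mult_right)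

lemma hybrid_integral_affine:
  fixes g :: "real \<Rightarrow> nat \<Rightarrow> real"
  assumes "segment_in D t j m \<tau>" "hybrid_integrable j m \<tau> g"
  shows "hybrid_integral j m \<tau> (\<lambda>s i. a + b * g s i)
    = a * segment_length j m \<tau> + b * hybrid_integral j m \<tau> g"
proof -
  have jm: "j \<le> m" using assms(1) by (simp add: segment_in_def)
  have "integral {\<tau> i..\<tau> (Suc i)} (\<lambda>s. a + b * g s i)
      = a * (\<tau> (Suc i) - \<tau> i) + b * integral {\<tau> i..\<tau> (Suc i)} (\<lambda>s. g s i)" if i: "i \<in> {j..m}" for i
  proof -
    have "(\<lambda>s. g s i) integrable_on {\<tau> i..\<tau> (Suc i)}"
      using assms(2) i by (auto simp: hybrid_integrable_def)
    then show ?thesis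
      using segment_in_order(1)[OF assms(1) i]
      by (subst integral_add) (auto intro!: integrable_on_mult_right simp: content_real)
  qed
  then have "(\<Sum>i=j..m. integral {\<tau> i..\<tau> (Suc i)} (\<lambda>s. a + b * g s i))
      = a * (\<tau> (Suc m) - \<tau> j) + b * (\<Sum>i=j..m. integral {\<tau> i..\<tau> (Suc i)} (\<lambda>s. g s i))"
    using jm by (simp add: sum.distrib sum_Suc_diff flip: sum_distrib_left)
  moreover have "(\<Sum>i=j..<m. a + b * g (\<tau> (Suc i)) i)
      = a * (real m - real j) + b * (\<Sum>i=j..<m. g (\<tau> (Suc i)) i)"
    using jm by (simp add: sum.distrib of_nat_diff flip: sum_distrib_left)
  ultimately show ?thesis
    by (simp add: hybrid_integral_def segment_length_def algebra_simps)
qed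

text \<open>Inside a window \<open>flow_jump\<close> is the flow part except at the two endpoints of each flow.\<close>

lemma hybrid_integrable_flow_jump:
  fixes F G :: "real \<Rightarrow> nat \<Rightarrow> 'a::euclidean_space"
  assumes seg: "segment_in D t j m \<tau>"
    and cont: "\<And>i. i \<in> {j..m} \<Longrightarrow> continuous_on {\<tau> i..\<tau> (Suc i)} (\<lambda>s. F s i)"
  shows "hybrid_integrable j m \<tau> (flow_jump D F G)"
  unfolding hybrid_integrable_def
proof
  fix i assume i: "i \<in> {j..m}"
  show "(\<lambda>s. flow_jump D F G s i) integrable_on {\<tau> i..\<tau> (Suc i)}"
  proof (rule integrable_spike_finite)
    show "(\<lambda>s. F s i) integrable_on {\<tau> i..\<tau> (Suc i)}"
      by (rule integrable_continuous_real[OF cont[OF i]])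
    show "flow_jump D F G s i = F s i" if "s \<in> {\<tau> i..\<tau> (Suc i)} - {\<tau> i, \<tau> (Suc i)}" for s
      using segment_in_interior[OF seg i, of s] that by (auto simp: flow_jump_def)
  qed simp
qed

text \<open>The hybrid integral of symmetric matrices is symmetric, so that the matrix inequality is a family
  of scalar ones.\<close>

lemma psd_le_hybrid_integral_iff:
  fixes \<Phi> :: "real \<Rightarrow> nat \<Rightarrow> real^'n^'n"
  assumes seg: "segment_in D t j m \<tau>" and int: "hybrid_integrable j m \<tau> \<Phi>"
    and sym: "\<And>s i. (s, i) \<in> D \<Longrightarrow> transpose (\<Phi> s i) = \<Phi> s i"
  shows "\<mu> *\<^sub>R mat 1 \<preceq> hybrid_integral j m \<tau> \<Phi> \<longleftrightarrow>
    (\<forall>x. \<mu> * (norm x)\<^sup>2 \<le> hybrid_integral j m \<tau> (\<lambda>s i. x \<bullet> (\<Phi> s i *v x)))"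
proof -
  have "transpose (hybrid_integral j m \<tau> \<Phi>) = hybrid_integral j m \<tau> (\<lambda>s i. transpose (\<Phi> s i))"
    by (rule hybrid_integral_linear[OF bounded_linear_transpose int, symmetric])
  also have "\<dots> = hybrid_integral j m \<tau> \<Phi>" by (rule hybrid_integral_cong[OF seg sym])
  finally show ?thesis
    by (simp add: psd_le_iff transpose_diff transpose_scalar dot_square_norm
        hybrid_integral_linear[OF bounded_linear_quadratic_form int]
        flip: scaleR_matrix_vector_assoc)
qed

section \<open>From excitation to observability\<close>

text \<open>A bound on the speed in the open interval is enough, as the endpoints do not contribute to
  the integral.\<close>

lemma flow_drift_le:
  fixes \<zeta> :: "real \<Rightarrow> 'a::euclidean_space"
  assumes "a \<le> s" "s \<le> b"
    and der: "\<And>r. r \<in> {a..b} \<Longrightarrow> (\<zeta> has_vector_derivative v r) (at r within {a..b})"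
    and h: "h integrable_on {a..b}" "\<And>r. r \<in> {a..b} \<Longrightarrow> 0 \<le> h r"
    and v: "\<And>r. r \<in> {a<..<b} \<Longrightarrow> norm (v r) \<le> h r"
  shows "norm (\<zeta> s - \<zeta> a) \<le> integral {a..b} h"
proof -
  define w where "w r = (if r \<in> {a<..<b} then v r else 0)" for r
  have "(v has_integral (\<zeta> s - \<zeta> a)) {a..s}"
    using assms(1,2)
    by (intro fundamental_theorem_of_calculus has_vector_derivative_within_subset[OF der]) auto
  then have w: "(w has_integral (\<zeta> s - \<zeta> a)) {a..s}"
    by (rule has_integral_spike_finite[where S = "{a, b}", rotated 2])
      (use assms(2) in \<open>auto simp: w_def\<close>)
  have hs: "h integrable_on {a..s}"
    by (rule integrable_on_subinterval[OF h(1)]) (use assms(2) in auto)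
  have "norm (integral {a..s} w) \<le> integral {a..s} h"
    using w v h(2) assms(2) by (intro integral_norm_bound_integral hs) (auto simp: w_def integrable_on_def)
  also have "\<dots> \<le> integral {a..b} h"
    using assms(2) h by (intro integral_subset_le hs) auto
  finally show ?thesis using w by (simp add: integral_unique)
qed

text \<open>If \<open>h\<close> dominates the speed of \<open>\<zeta>\<close> along flows and the size of its jumps, then the hybrid
  integral of \<open>h\<close> dominates the displacement: the integral counts a jump like one unit of flow.
  Endpoints of flows are excluded from the bound on the speed because there \<open>flow_jump\<close> may take
  its value for jumps.\<close>

lemma hybrid_drift_le:
  fixes \<zeta> :: "real \<Rightarrow> nat \<Rightarrow> 'a::euclidean_space"
  assumes seg: "segment_in D t j m \<tau>"
    and flow: "\<And>i s. i \<in> {j..m} \<Longrightarrow> s \<in> {\<tau> i..\<tau> (Suc i)} \<Longrightarrow>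
      ((\<lambda>s. \<zeta> s i) has_vector_derivative v s i) (at s within {\<tau> i..\<tau> (Suc i)})"
    and v: "\<And>i s. i \<in> {j..m} \<Longrightarrow> s \<in> {\<tau> i<..<\<tau> (Suc i)} \<Longrightarrow> norm (v s i) \<le> h s i"
    and jump: "\<And>i. i \<in> {j..<m} \<Longrightarrow>
      norm (\<zeta> (\<tau> (Suc i)) (Suc i) - \<zeta> (\<tau> (Suc i)) i) \<le> h (\<tau> (Suc i)) i"
    and h: "hybrid_integrable j m \<tau> h" "\<And>s i. (s, i) \<in> D \<Longrightarrow> 0 \<le> h s i"
    and k: "k \<in> {j..m}" "s \<in> {\<tau> k..\<tau> (Suc k)}"
  shows "norm (\<zeta> s k - \<zeta> t j) \<le> hybrid_integral j m \<tau> h"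
proof -
  let ?I = "\<lambda>i. integral {\<tau> i..\<tau> (Suc i)} (\<lambda>s. h s i)"
  have hint: "(\<lambda>s. h s i) integrable_on {\<tau> i..\<tau> (Suc i)}" if "i \<in> {j..m}" for i
    using h(1) that by (auto simp: hybrid_integrable_def)
  have flow_step: "norm (\<zeta> s i - \<zeta> (\<tau> i) i) \<le> ?I i" if i: "i \<in> {j..m}" "s \<in> {\<tau> i..\<tau> (Suc i)}" for i s
    by (rule flow_drift_le[where v = "\<lambda>s. v s i", OF _ _ flow[OF i(1)] hint[OF i(1)] _ v[OF i(1)]])
      (use i segment_in_domain[OF seg i(1)] h(2) in auto)
  have tj: "\<tau> j = t" using seg by (simp add: segment_in_def)
  have Inn: "0 \<le> ?I i" if "i \<in> {j..m}" for i
    by (rule integral_nonneg[OF hint[OF that]]) (rule h(2)[OF segment_in_domain[OF seg that]])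
  have hnn: "0 \<le> h (\<tau> (Suc i)) i" if "i \<in> {j..m}" for i
    using segment_in_order(1)[OF seg that] by (intro h(2) segment_in_domain[OF seg that]) auto
  have start: "norm (\<zeta> (\<tau> n) n - \<zeta> t j) \<le> (\<Sum>i=j..<n. ?I i) + (\<Sum>i=j..<n. h (\<tau> (Suc i)) i)"
    if "j \<le> n" "n \<le> m" for n
    using that
  proof (induction n rule: dec_induct)
    case base
    show ?case by (simp add: tj)
  next
    case (step n)
    have n: "n \<in> {j..m}" "n \<in> {j..<m}" "n \<le> m" using step by auto
    have "norm (\<zeta> (\<tau> (Suc n)) n - \<zeta> (\<tau> n) n) \<le> ?I n"
      using flow_step[OF n(1), of "\<tau> (Suc n)"] segment_in_order(1)[OF seg n(1)] by auto
    with jump[OF n(2)] step.IH[OF n(3)]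
    have "norm (\<zeta> (\<tau> (Suc n)) (Suc n) - \<zeta> t j)
        \<le> (\<Sum>i=j..<n. ?I i) + (\<Sum>i=j..<n. h (\<tau> (Suc i)) i) + ?I n + h (\<tau> (Suc n)) n"
      by norm
    then show ?case using step by (simp add: sum.atLeastLessThan_Suc)
  qed
  have "norm (\<zeta> s k - \<zeta> t j) \<le> (\<Sum>i=j..<k. ?I i) + (\<Sum>i=j..<k. h (\<tau> (Suc i)) i) + ?I k"
    using flow_step[OF k] start[of k] k(1) norm_triangle_ineq[of "\<zeta> s k - \<zeta> (\<tau> k) k" "\<zeta> (\<tau> k) k - \<zeta> t j"]
    by auto
  also have "\<dots> = (\<Sum>i=j..<Suc k. ?I i) + (\<Sum>i=j..<k. h (\<tau> (Suc i)) i)"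
    using k(1) by (simp add: sum.atLeastLessThan_Suc)
  also have "\<dots> \<le> hybrid_integral j m \<tau> h"
    unfolding hybrid_integral_def using k(1) Inn hnn by (intro add_mono sum_mono2) auto
  finally show ?thesis .
qed

text \<open>Suppose that the dissipation \<open>W = \<integral> \<zeta> \<bullet> \<Phi> \<zeta>\<close> were below \<open>\<kappa> |x|\<^sup>2 = \<eta>\<^sup>2\<close>, where \<open>x = \<zeta> t j\<close>. By
  Young's inequality with parameter \<open>\<eta>\<close> the solution then stays within \<open>R = \<eta> (L + c) / 2\<close> of
  \<open>x\<close>, hence \<open>\<mu> |x|\<^sup>2 \<le> \<integral> x \<bullet> \<Phi> x \<le> 2 W + 2 c R\<^sup>2 L < (2 + c L (L + c)\<^sup>2 / 2) \<eta>\<^sup>2\<close>. The value of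
  \<open>\<kappa>\<close> is the one for which the right-hand side is \<open>\<mu> |x|\<^sup>2\<close>.\<close>

lemma excitation_imp_observability:
  fixes \<Phi> :: "real \<Rightarrow> nat \<Rightarrow> real^'n^'n" and \<zeta> :: "real \<Rightarrow> nat \<Rightarrow> real^'n"
  assumes seg: "segment_in D t j m \<tau>" and length: "segment_length j m \<tau> \<le> L" and pos: "0 < c" "0 < L" "0 < \<mu>"
    and \<Phi>: "\<And>s i. (s, i) \<in> D \<Longrightarrow> psd (\<Phi> s i) \<and> mat_norm (\<Phi> s i) \<le> c"
    and flow: "\<And>i s. i \<in> {j..m} \<Longrightarrow> s \<in> {\<tau> i..\<tau> (Suc i)} \<Longrightarrow>
      ((\<lambda>s. \<zeta> s i) has_vector_derivative v s i) (at s within {\<tau> i..\<tau> (Suc i)})"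
    and v: "\<And>i s. i \<in> {j..m} \<Longrightarrow> s \<in> {\<tau> i<..<\<tau> (Suc i)} \<Longrightarrow> v s i = - (\<Phi> s i *v \<zeta> s i)"
    and jump: "\<And>i. i \<in> {j..<m} \<Longrightarrow> \<zeta> (\<tau> (Suc i)) (Suc i)
      = \<zeta> (\<tau> (Suc i)) i - \<Phi> (\<tau> (Suc i)) i *v \<zeta> (\<tau> (Suc i)) i"
    and int\<Phi>: "hybrid_integrable j m \<tau> \<Phi>"
    and intq: "hybrid_integrable j m \<tau> (\<lambda>s i. \<zeta> s i \<bullet> (\<Phi> s i *v \<zeta> s i))"
    and excited: "\<mu> *\<^sub>R mat 1 \<preceq> hybrid_integral j m \<tau> \<Phi>"
  shows "\<mu> / (2 + c * L * (L + c)\<^sup>2 / 2) * (norm (\<zeta> t j))\<^sup>2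
    \<le> hybrid_integral j m \<tau> (\<lambda>s i. \<zeta> s i \<bullet> (\<Phi> s i *v \<zeta> s i))"
proof (rule ccontr)
  let ?q = "\<lambda>s i. \<zeta> s i \<bullet> (\<Phi> s i *v \<zeta> s i)"
  define x where "x = \<zeta> t j"
  define W where "W = hybrid_integral j m \<tau> ?q"
  define len where "len = segment_length j m \<tau>"
  define G where "G = 2 + c * L * (L + c)\<^sup>2 / 2"
  define \<kappa> where "\<kappa> = \<mu> / G"
  assume "\<not> ?thesis"
  then have small: "W < \<kappa> * (norm x)\<^sup>2" by (simp add: W_def \<kappa>_def G_def x_def)
  have G: "0 < G" using pos by (simp add: G_def add_pos_nonneg)
  have \<kappa>: "0 < \<kappa>" using pos G by (simp add: \<kappa>_def)
  have q_nonneg: "0 \<le> ?q s i" if "(s, i) \<in> D" for s i using \<Phi>[OF that] by (simp add: psd_def)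
  have int0: "hybrid_integrable j m \<tau> (\<lambda>_ _. 0 :: real)"
    by (auto simp: hybrid_integrable_def intro: integrable_0)
  have W0: "0 \<le> W"
    using hybrid_integral_mono[OF seg int0 intq q_nonneg] by (simp add: W_def hybrid_integral_def)
  have len: "0 \<le> len" "len \<le> L"
  proof -
    have "j \<le> m" using seg by (simp add: segment_in_def)
    then have "t \<le> \<tau> (Suc m)" "real j \<le> real m" using segment_in_order[OF seg, of m] by auto
    then show "0 \<le> len" using seg by (simp add: len_def segment_length_def segment_in_def)
    show "len \<le> L" using length by (simp add: len_def)
  qed
  define \<eta> where "\<eta> = sqrt \<kappa> * norm x"
  have \<eta>2: "\<eta>\<^sup>2 = \<kappa> * (norm x)\<^sup>2" using \<kappa> by (simp add: \<eta>_def power_mult_distrib)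
  have "x \<noteq> 0" using small W0 by auto
  then have \<eta>: "0 < \<eta>" using \<kappa> by (simp add: \<eta>_def)
  define h where "h s i = \<eta> / 2 + c / (2 * \<eta>) * ?q s i" for s i
  have inth: "hybrid_integrable j m \<tau> h" unfolding h_def by (rule hybrid_integrable_affine[OF intq])
  have speed: "norm (\<Phi> s i *v \<zeta> s i) \<le> h s i" if "(s, i) \<in> D" for s i
    unfolding h_def using \<Phi>[OF that] \<eta> pos by (intro psd_norm_le_young) auto
  define R where "R = \<eta> * (L + c) / 2"
  have "hybrid_integral j m \<tau> h = \<eta> / 2 * len + c / (2 * \<eta>) * W"
    unfolding h_def W_def len_def by (rule hybrid_integral_affine[OF seg intq])
  also have "\<dots> \<le> \<eta> / 2 * L + c / (2 * \<eta>) * \<eta>\<^sup>2"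
    using len \<eta> pos small \<eta>2 by (intro add_mono mult_left_mono) auto
  also have "\<dots> = R" using \<eta> by (simp add: R_def power2_eq_square field_simps)
  finally have hR: "hybrid_integral j m \<tau> h \<le> R" .
  have drift: "norm (\<zeta> s k - x) \<le> R" if "k \<in> {j..m}" "s \<in> {\<tau> k..\<tau> (Suc k)}" for s k
  proof -
    have "norm (\<zeta> s k - \<zeta> t j) \<le> hybrid_integral j m \<tau> h"
    proof (rule hybrid_drift_le[OF seg flow _ _ inth _ that])
      show "norm (v s i) \<le> h s i" if "i \<in> {j..m}" "s \<in> {\<tau> i<..<\<tau> (Suc i)}" for i s
        using speed[OF segment_in_domain[OF seg that(1)], of s] that v[OF that] by simp
      show "norm (\<zeta> (\<tau> (Suc i)) (Suc i) - \<zeta> (\<tau> (Suc i)) i) \<le> h (\<tau> (Suc i)) i" if "i \<in> {j..<m}" for i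
        using that segment_in_order(1)[OF seg, of i]
        by (simp add: jump[OF that]) (intro speed segment_in_domain[OF seg], auto)
      show "0 \<le> h s i" if "(s, i) \<in> D" for s i
        using speed[OF that] norm_ge_zero order_trans by blast
    qed
    with hR show ?thesis by (simp add: x_def)
  qed
  have form: "x \<bullet> (\<Phi> s i *v x) \<le> 2 * c * R\<^sup>2 + 2 * ?q s i"
    if "i \<in> {j..m}" "s \<in> {\<tau> i..\<tau> (Suc i)}" for s i
  proof -
    have "x \<bullet> (\<Phi> s i *v x) \<le> 2 * ?q s i + 2 * c * (norm (\<zeta> s i - x))\<^sup>2"
      using \<Phi>[OF segment_in_domain[OF seg that]] by (intro psd_form_le_twice) auto
    also have "(norm (\<zeta> s i - x))\<^sup>2 \<le> R\<^sup>2" using drift[OF that] by (intro power_mono) auto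
    finally show ?thesis using pos by (simp add: add.commute)
  qed
  have "\<mu> * (norm x)\<^sup>2 = x \<bullet> ((\<mu> *\<^sub>R mat 1) *v x)"
    by (simp add: dot_square_norm flip: scaleR_matrix_vector_assoc)
  also have "\<dots> \<le> x \<bullet> (hybrid_integral j m \<tau> \<Phi> *v x)"
    using excited by (simp add: psd_le_iff)
  also have "\<dots> = hybrid_integral j m \<tau> (\<lambda>s i. x \<bullet> (\<Phi> s i *v x))"
    by (rule hybrid_integral_linear[OF bounded_linear_quadratic_form int\<Phi>, symmetric])
  also have "\<dots> \<le> hybrid_integral j m \<tau> (\<lambda>s i. 2 * c * R\<^sup>2 + 2 * ?q s i)"
    \<comment> \<open>The bound is known on the window only, so the window itself serves as the domain.\<close>
  proof (rule hybrid_integral_mono)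
    show "segment_in (htd_segment j m \<tau>) t j m \<tau>" using seg by (simp add: segment_in_def)
    show "x \<bullet> (\<Phi> s i *v x) \<le> 2 * c * R\<^sup>2 + 2 * ?q s i" if "(s, i) \<in> htd_segment j m \<tau>" for s i
      using that form by (auto simp: htd_segment_def)
  qed (intro hybrid_integrable_linear[OF bounded_linear_quadratic_form int\<Phi>]
      hybrid_integrable_affine[OF intq])+
  also have "\<dots> = 2 * c * R\<^sup>2 * len + 2 * W"
    unfolding W_def len_def by (rule hybrid_integral_affine[OF seg intq])
  also have "\<dots> < 2 * c * R\<^sup>2 * L + 2 * \<eta>\<^sup>2"
    using small len pos by (intro add_le_less_mono mult_left_mono) (auto simp: \<eta>2)
  also have "\<dots> = G * \<eta>\<^sup>2" by (simp add: R_def G_def power2_eq_square field_simps)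
  also have "\<dots> = \<mu> * (norm x)\<^sup>2" using G by (simp add: \<eta>2 \<kappa>_def)
  finally show False by simp
qed

section \<open>Branching time domains\<close>

text \<open>In a hybrid time domain a jump at time \<open>b\<close> may leave the interior of the flow interval of
  \<open>i\<close>, as in \<open>D = {0..} \<times> {0} \<union> {1} \<times> UNIV\<close>. The definition looks at the past of each
  point only, and the two branches are not in each other's past. Time then stops on the jumping
  branch, because a later time there would have the flow of \<open>i\<close> beyond \<open>b\<close> in its past.\<close>

lemma branch_tail:
  assumes dom: "hybrid_time_domain D" and b: "b \<in> interior (flow_interval D i)" "(b, Suc i) \<in> D"
    and s: "(s, k) \<in> D" "i < k"
  shows "s = b"
proof -
  have bi: "(b, i) \<in> D" using b interior_subset by (force simp: flow_interval_def)
  obtain e where e: "0 < e" "ball b e \<subseteq> flow_interval D i"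
    using b(1) by (auto simp: mem_interior)
  have after: "(u, i) \<in> D" if "b \<le> u" "u < b + e" for u
    using e that by (auto simp: flow_interval_def dist_real_def subset_iff)
  obtain \<tau> where \<tau>: "breakpoints D s k \<tau>"
    using htd_breakpoints[OF dom s(1)] by blast
  note mono = breakpointsD(1)[OF \<tau>] and last = breakpointsD(2)[OF \<tau>]
    and inD = breakpointsD(3)[OF \<tau>] and D = breakpointsD(4)[OF \<tau>]
  show ?thesis
  proof (rule antisym)
    show "s \<le> b"
    proof (rule ccontr)
      assume "\<not> s \<le> b"
      then obtain u where u: "b < u" "u < b + e" "u \<le> s"
        by (metis add_strict_left_mono dense e(1) add.right_neutral less_imp_le linorder_not_le
            min_less_iff_conj)
      have "u \<le> \<tau> (Suc i)" using D[of i u] after[of u] u s by auto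
      moreover have "\<tau> (Suc i) \<le> b" using D[of "Suc i" b] b(2) \<open>\<not> s \<le> b\<close> s by auto
      ultimately show False using u by simp
    qed
    have "\<tau> (Suc i) \<le> \<tau> (Suc k)"
      by (rule breakpoints_mono[where m = 0 and n = "Suc k"]) (use mono s in auto)
    moreover have "(\<tau> (Suc i), Suc i) \<in> D" using inD[of "Suc i" "\<tau> (Suc i)"] mono[of "Suc i"] s by auto
    ultimately show "b \<le> s"
      using jump_time_le_later_flow[OF dom bi b(2)] last by fastforce
  qed
qed

lemma branch_index_unique:
  assumes dom: "hybrid_time_domain D"
    and "b \<in> interior (flow_interval D i)" "(b, Suc i) \<in> D"
    and "b' \<in> interior (flow_interval D k)" "(b', Suc k) \<in> D"
  shows "k = i"
proof -
  have *: "\<not> i < k" if "b \<in> interior (flow_interval D i)" "(b, Suc i) \<in> D"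
    "b' \<in> interior (flow_interval D k)" for b b' i k
  proof
    assume "i < k"
    then have "flow_interval D k \<subseteq> {b}"
      using branch_tail[OF dom that(1,2)] by (auto simp: flow_interval_def)
    with that(3) interior_mono[OF this] show False by simp
  qed
  show ?thesis using *[OF assms(2-4)] *[OF assms(4,5,2)] by simp
qed

lemma hybrid_integral_single:
  "hybrid_integral j j \<tau> g = integral {\<tau> j..\<tau> (Suc j)} (\<lambda>s. g s j)"
  by (simp add: hybrid_integral_def)

lemma hybrid_integral_vertical:
  assumes "\<And>k. k \<in> {j..Suc m} \<Longrightarrow> \<tau> k = b"
  shows "hybrid_integral j m \<tau> g = (\<Sum>k=j..<m. g b k)"
proof -
  have "integral {\<tau> k..\<tau> (Suc k)} (\<lambda>s. g s k) = 0" if "k \<in> {j..m}" for k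
    using assms[of k] assms[of "Suc k"] that by simp
  moreover have "\<tau> (Suc k) = b" if "k \<in> {j..<m}" for k using assms[of "Suc k"] that by simp
  ultimately show ?thesis by (simp add: hybrid_integral_def)
qed

lemma vertical_breakpoints:
  assumes seg: "segment_in D t j m \<tau>" and vert: "\<And>s k. (s, k) \<in> D \<Longrightarrow> j \<le> k \<Longrightarrow> s = b"
    and k: "k \<in> {j..Suc m}"
  shows "\<tau> k = b"
proof (cases "k \<le> m")
  case True
  then have "k \<in> {j..m}" using k by simp
  then show ?thesis
    using segment_in_domain[OF seg, of k "\<tau> k"] segment_in_order(1)[OF seg, of k] vert[of "\<tau> k" k] by auto
next
  case False
  moreover have "j \<le> m" using seg by (simp add: segment_in_def)
  ultimately show ?thesis
    using segment_in_domain[OF seg, of m "\<tau> k"] segment_in_order(1)[OF seg, of m] vert[of "\<tau> k" m] k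
    by (auto simp: le_Suc_eq)
qed

text \<open>At a jump out of the interior of a flow interval, \<open>flow_jump\<close> is \<open>A\<close> although the solution
  jumps by \<open>B\<close>, so excitation over a window with such a jump says nothing about solutions. Such
  windows can be avoided at the price of a larger length \<open>K'\<close>. There is only one index \<open>i\<close> where
  the domain branches. A window from a point at or before \<open>i\<close> can follow the flow of \<open>i\<close>; with
  \<open>K' = b + i + K + 2\<close> it contains a window of length \<open>K\<close> that starts after the time \<open>b\<close> of
  the branching, where there is no choice but to flow. A window from a point above \<open>i\<close> consists of
  jumps only, and extends the given window from that point.\<close>

lemma windows_without_branch_jumps:
  fixes A B :: "real \<Rightarrow> nat \<Rightarrow> real^'n^'n"
  assumes dom: "hybrid_time_domain D" and arcA: "hybrid_arc D A" and K: "0 < K"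
    and psd: "\<And>s i. (s, i) \<in> D \<Longrightarrow> psd (flow_jump D A B s i)"
    and excited: "\<And>t j. (t, j) \<in> D \<Longrightarrow> window_integral_ge D t j K \<mu> (flow_jump D A B)"
  shows "\<exists>K'>0. \<forall>(t, j)\<in>D. \<exists>m \<tau>. shortest_window D t j K' m \<tau> \<and>
    (\<forall>i\<in>{j..<m}. \<tau> (Suc i) \<notin> interior (flow_interval D i)) \<and>
    hybrid_integrable j m \<tau> (flow_jump D A B) \<and>
    \<mu> *\<^sub>R mat 1 \<preceq> hybrid_integral j m \<tau> (flow_jump D A B)"
proof (cases "\<exists>i b. b \<in> interior (flow_interval D i) \<and> (b, Suc i) \<in> D")
  case False
  show ?thesis
  proof (intro exI[of _ K] conjI K ballI, clarify)
    fix t j assume tj: "(t, j) \<in> D"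
    obtain m \<tau> where W: "shortest_window D t j K m \<tau>"
      and rest: "hybrid_integrable j m \<tau> (flow_jump D A B)"
      "\<mu> *\<^sub>R mat 1 \<preceq> hybrid_integral j m \<tau> (flow_jump D A B)"
      using excited[OF tj] unfolding window_integral_ge_def by blast
    have seg: "segment_in D t j m \<tau>" using W by (simp add: shortest_window_def)
    have "\<tau> (Suc i) \<notin> interior (flow_interval D i)" if "i \<in> {j..<m}" for i
    proof -
      have "(\<tau> (Suc i), Suc i) \<in> D"
        using that segment_in_order(1)[OF seg, of "Suc i"] by (intro segment_in_domain[OF seg]) auto
      with False show ?thesis by blast
    qed
    with W rest show "\<exists>m \<tau>. shortest_window D t j K m \<tau> \<and>
        (\<forall>i\<in>{j..<m}. \<tau> (Suc i) \<notin> interior (flow_interval D i)) \<and>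
        hybrid_integrable j m \<tau> (flow_jump D A B) \<and>
        \<mu> *\<^sub>R mat 1 \<preceq> hybrid_integral j m \<tau> (flow_jump D A B)" by blast
  qed
next
  case True
  let ?\<Phi> = "flow_jump D A B"
  obtain i b where b: "b \<in> interior (flow_interval D i)" "(b, Suc i) \<in> D" using True by blast
  have tail: "s = b" if "(s, k) \<in> D" "i < k" for s k by (rule branch_tail[OF dom b that])
  have bi: "(b, i) \<in> D" using b(1) interior_subset by (force simp: flow_interval_def)
  have b0: "0 \<le> b" using bi dom unfolding hybrid_time_domain_def by auto
  have sym: "transpose (?\<Phi> s k) = ?\<Phi> s k" if "(s, k) \<in> D" for s k
    using psd[OF that] by (simp add: psd_def)
  have nonneg: "0 \<le> x \<bullet> (?\<Phi> s k *v x)" if "(s, k) \<in> D" for s k x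
    using psd[OF that] by (simp add: psd_def)
  have no_branch: "\<tau> (Suc k) \<notin> interior (flow_interval D k)"
    if "segment_in D t j m \<tau>" "k \<in> {j..<m}" "k \<noteq> i" for t j m k and \<tau> :: "nat \<Rightarrow> real"
  proof -
    have "(\<tau> (Suc k), Suc k) \<in> D"
      using that segment_in_order(1)[OF that(1), of "Suc k"]
      by (intro segment_in_domain[OF that(1)]) auto
    then show ?thesis using branch_index_unique[OF dom b] that(3) by blast
  qed
  \<comment> \<open>Above \<open>i\<close> a window is a sequence of jumps at time \<open>b\<close>.\<close>
  have tail_window: "\<exists>m\<ge>j. K \<le> real (m - j) \<and> real (m - j) \<le> K + 1 \<and> (b, Suc j) \<in> D \<and>
      (\<forall>x. \<mu> * (norm x)\<^sup>2 \<le> (\<Sum>k=j..<m. x \<bullet> (?\<Phi> b k *v x)))"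
    if j: "(b, j) \<in> D" "i < j" for j
  proof -
    obtain m \<tau> where W: "shortest_window D b j K m \<tau>" and int: "hybrid_integrable j m \<tau> ?\<Phi>"
      and ge: "\<mu> *\<^sub>R mat 1 \<preceq> hybrid_integral j m \<tau> ?\<Phi>"
      using excited[OF j(1)] unfolding window_integral_ge_def by blast
    have seg: "segment_in D b j m \<tau>" and len: "K \<le> segment_length j m \<tau>"
      using W by (simp_all add: shortest_window_def)
    have jm: "j \<le> m" using seg by (simp add: segment_in_def)
    have \<tau>: "\<tau> k = b" if "k \<in> {j..Suc m}" for k
      by (rule vertical_breakpoints[OF seg _ that]) (use tail j(2) in auto)
    have m: "segment_length j m \<tau> = real (m - j)"
      using \<tau>[of j] \<tau>[of "Suc m"] jm by (simp add: segment_length_def of_nat_diff)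
    with len K have "Suc j \<in> {j..m}" by auto
    then have "(b, Suc j) \<in> D"
      using segment_in_domain[OF seg, of "Suc j" b] \<tau>[of "Suc j"] \<tau>[of "Suc (Suc j)"] by simp
    moreover have "\<mu> * (norm x)\<^sup>2 \<le> (\<Sum>k=j..<m. x \<bullet> (?\<Phi> b k *v x))" for x
    proof -
      have "\<mu> * (norm x)\<^sup>2 \<le> hybrid_integral j m \<tau> (\<lambda>s k. x \<bullet> (?\<Phi> s k *v x))"
        using ge by (simp add: psd_le_hybrid_integral_iff[OF seg int sym])
      also have "\<dots> = (\<Sum>k=j..<m. x \<bullet> (?\<Phi> b k *v x))"
        by (rule hybrid_integral_vertical[OF \<tau>])
      finally show ?thesis .
    qed
    ultimately show ?thesis
      using len m shortest_window_length_le[OF W K] jm by (intro exI[of _ m]) auto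
  qed
  have tail_infinite: "(b, k) \<in> D" if "i < k" for k
  proof -
    have "Suc i \<le> k" using that by simp
    then show ?thesis
    proof (induction k rule: dec_induct)
      case (step n)
      then show ?case using tail_window[of n] by auto
    qed (rule b(2))
  qed
  \<comment> \<open>After time \<open>b\<close> a window is a single flow with index \<open>i\<close>. The slack of 1 comes from the bound
    on the length of windows.\<close>
  have flow_window: "\<exists>v\<ge>u + K. v \<le> u + K + 1 \<and> (v, i) \<in> D \<and>
      (\<forall>x. \<mu> * (norm x)\<^sup>2 \<le> integral {u..v} (\<lambda>s. x \<bullet> (?\<Phi> s i *v x)))"
    if u: "(u, i) \<in> D" "b < u" for u
  proof -
    obtain m \<tau> where W: "shortest_window D u i K m \<tau>" and int: "hybrid_integrable i m \<tau> ?\<Phi>"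
      and ge: "\<mu> *\<^sub>R mat 1 \<preceq> hybrid_integral i m \<tau> ?\<Phi>"
      using excited[OF u(1)] unfolding window_integral_ge_def by blast
    have seg: "segment_in D u i m \<tau>" and len: "K \<le> segment_length i m \<tau>"
      using W by (simp_all add: shortest_window_def)
    have im: "i \<le> m" and \<tau>i: "\<tau> i = u" using seg by (simp_all add: segment_in_def)
    have mi: "m = i"
    proof (rule ccontr)
      assume "m \<noteq> i"
      then have si: "Suc i \<in> {i..m}" using im by simp
      have "(\<tau> (Suc i), Suc i) \<in> D"
        using segment_in_order(1)[OF seg si] by (intro segment_in_domain[OF seg si]) auto
      with tail segment_in_order(2)[OF seg si] u(2) show False by fastforce
    qed
    have "(\<tau> (Suc i), i) \<in> D"
      using segment_in_order(1)[OF seg, of i] im by (intro segment_in_domain[OF seg]) auto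
    moreover have "\<forall>x. \<mu> * (norm x)\<^sup>2 \<le> integral {u..\<tau> (Suc i)} (\<lambda>s. x \<bullet> (?\<Phi> s i *v x))"
    proof -
      have "\<forall>x. \<mu> * (norm x)\<^sup>2 \<le> hybrid_integral i m \<tau> (\<lambda>s k. x \<bullet> (?\<Phi> s k *v x))"
        using ge by (simp add: psd_le_hybrid_integral_iff[OF seg int sym])
      then show ?thesis by (simp add: mi hybrid_integral_single \<tau>i)
    qed
    moreover have "u + K \<le> \<tau> (Suc i)" "\<tau> (Suc i) \<le> u + K + 1"
      using len shortest_window_length_le[OF W K] by (simp_all add: segment_length_def mi \<tau>i)
    ultimately show ?thesis by blast
  qed
  have flow_unbounded: "(T, i) \<in> D" if "b \<le> T" for T
  proof -
    obtain e where e: "0 < e" "ball b e \<subseteq> flow_interval D i"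
      using b(1) by (auto simp: mem_interior)
    then have start: "(b + e / 2, i) \<in> D" by (auto simp: flow_interval_def dist_real_def subset_iff)
    have "\<exists>v. b + e / 2 + real n * K \<le> v \<and> (v, i) \<in> D" for n
    proof (induction n)
      case 0
      show ?case using start by (intro exI[of _ "b + e / 2"]) simp
    next
      case (Suc n)
      then obtain v where v: "b + e / 2 + real n * K \<le> v" "(v, i) \<in> D" by blast
      have "0 \<le> real n * K" using K by simp
      then have "b < v" using v(1) e(1) by linarith
      from flow_window[OF v(2) this] obtain w where "v + K \<le> w" "(w, i) \<in> D" by blast
      with v(1) show ?case by (intro exI[of _ w]) (simp add: algebra_simps)
    qed
    moreover obtain n where "T < real n * K" using reals_Archimedean3[OF K] by blast
    ultimately obtain v where v: "b + e / 2 + real n * K \<le> v" "(v, i) \<in> D" by blast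
    then have "T \<le> v" using \<open>T < real n * K\<close> b0 e(1) by linarith
    with mem_is_interval_1_I[OF flow_interval_is_interval[OF dom, of i], of b v T] bi v(2) that
    show ?thesis by (simp add: flow_interval_def)
  qed
  define K' where "K' = b + real i + K + 2"
  have K': "0 < K'" using K b0 by (simp add: K'_def)
  show ?thesis
  proof (intro exI[of _ K'] conjI K' ballI, clarify)
    fix t j assume tj: "(t, j) \<in> D"
    show "\<exists>m \<tau>. shortest_window D t j K' m \<tau> \<and>
        (\<forall>i\<in>{j..<m}. \<tau> (Suc i) \<notin> interior (flow_interval D i)) \<and>
        hybrid_integrable j m \<tau> ?\<Phi> \<and> \<mu> *\<^sub>R mat 1 \<preceq> hybrid_integral j m \<tau> ?\<Phi>"
    proof (cases "i < j")
      case True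
      have tb: "t = b" by (rule tail[OF tj True])
      define N where "N = nat \<lceil>K'\<rceil>"
      have N: "K' \<le> real N" "\<And>n :: nat. K' \<le> real n \<Longrightarrow> N \<le> n"
        by (simp_all add: N_def real_nat_ceiling_ge nat_le_iff ceiling_le_iff)
      have seg: "segment_in D t j (j + N) (\<lambda>_. b)"
        using tail_infinite True by (auto simp: segment_in_def htd_segment_def tb)
      have int: "hybrid_integrable j (j + N) (\<lambda>_. b) ?\<Phi>"
        by (rule hybrid_integrable_flow_jump[OF seg]) simp
      have "shortest_window D t j K' (j + N) (\<lambda>_. b)"
        unfolding shortest_window_def
      proof (intro conjI allI impI seg)
        show "K' \<le> segment_length j (j + N) (\<lambda>_. b)" using N(1) by (simp add: segment_length_def)
        fix m \<tau> assume other: "segment_in D t j m \<tau> \<and> K' \<le> segment_length j m \<tau>"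
        have "\<tau> k = b" if "k \<in> {j..Suc m}" for k
          by (rule vertical_breakpoints[OF conjunct1[OF other] _ that]) (use tail True in auto)
        moreover have "j \<le> m" using other by (simp add: segment_in_def)
        ultimately have "segment_length j m \<tau> = real (m - j)"
          by (simp add: segment_length_def of_nat_diff)
        with other N(2)[of "m - j"] show "segment_length j (j + N) (\<lambda>_. b) \<le> segment_length j m \<tau>"
          by (simp add: segment_length_def)
      qed
      moreover have vertical: "\<forall>k\<in>{j..<j + N}. b \<notin> interior (flow_interval D k)"
        using no_branch[OF seg] True by auto
      have larger: "\<mu> * (norm x)\<^sup>2 \<le> (\<Sum>k=j..<j + N. x \<bullet> (?\<Phi> b k *v x))" for x
      proof -
        obtain m where m: "j \<le> m" "real (m - j) \<le> K + 1"
          and ge: "\<mu> * (norm x)\<^sup>2 \<le> (\<Sum>k=j..<m. x \<bullet> (?\<Phi> b k *v x))"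
          using tail_window[OF tj[unfolded tb] True] by blast
        have "real (m - j) \<le> real N" using m(2) N(1) b0 by (simp add: K'_def)
        then have "m \<le> j + N" by simp
        then have "(\<Sum>k=j..<m. x \<bullet> (?\<Phi> b k *v x)) \<le> (\<Sum>k=j..<j + N. x \<bullet> (?\<Phi> b k *v x))"
          using True by (intro sum_mono2 nonneg tail_infinite) auto
        with ge show ?thesis by simp
      qed
      moreover have "\<mu> *\<^sub>R mat 1 \<preceq> hybrid_integral j (j + N) (\<lambda>_. b) ?\<Phi>"
        using larger by (subst psd_le_hybrid_integral_iff[OF seg int sym])
          (auto simp: hybrid_integral_vertical[where b = b])
      ultimately show ?thesis using int vertical by blast
    next
      case False
      then have ji: "j \<le> i" by simp
      define T where "T = K' + t - (real i - real j)"
      have t0: "0 \<le> t" using tj dom unfolding hybrid_time_domain_def by auto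
      have T: "b + K + 2 \<le> T" "t + K + 2 \<le> T"
        using t0 b0 by (simp_all add: T_def K'_def)
      have "(T, i) \<in> D" using T(1) K by (intro flow_unbounded) simp
      from htd_breakpoints[OF dom this] obtain \<sigma> where \<sigma>: "breakpoints D T i \<sigma>" by blast
      \<comment> \<open>The path to \<open>(T, i)\<close>, started at \<open>t\<close>; its length is exactly \<open>K'\<close>, so it is shortest.\<close>
      define \<tau> where "\<tau> = \<sigma>(j := t)"
      have \<sigma>j: "\<sigma> j \<le> t" "t \<le> \<sigma> (Suc j)"
        using breakpointsD(4)[OF \<sigma> ji _ tj] T(2) K by auto
      have last: "\<tau> (Suc i) = T" using breakpointsD(2)[OF \<sigma>] ji by (simp add: \<tau>_def)
      have seg: "segment_in D t j i \<tau>"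
        unfolding segment_in_def
      proof (intro conjI ji ballI)
        show "\<tau> j = t" by (simp add: \<tau>_def)
        show "\<tau> k \<le> \<tau> (Suc k)" if "k \<in> {j..i}" for k
          using breakpointsD(1)[OF \<sigma>, of k] \<sigma>j that by (auto simp: \<tau>_def)
        show "htd_segment j i \<tau> \<subseteq> D"
        proof
          fix p assume "p \<in> htd_segment j i \<tau>"
          then obtain s k where p: "p = (s, k)" "k \<in> {j..i}" "\<tau> k \<le> s" "s \<le> \<tau> (Suc k)"
            by (auto simp: htd_segment_def)
          have "\<sigma> k \<le> s" "s \<le> \<sigma> (Suc k)" using p \<sigma>j by (auto simp: \<tau>_def split: if_splits)
          with breakpointsD(3)[OF \<sigma>, of k s] p(1,2) show "p \<in> D" by simp
        qed
      qed
      have "segment_length j i \<tau> = K'"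
        using seg by (simp add: segment_length_def last segment_in_def T_def)
      then have "shortest_window D t j K' i \<tau>" by (simp add: shortest_window_def seg)
      moreover have "\<forall>k\<in>{j..<i}. \<tau> (Suc k) \<notin> interior (flow_interval D k)"
        using no_branch[OF seg] by auto
      moreover have int: "hybrid_integrable j i \<tau> ?\<Phi>"
        by (intro hybrid_integrable_flow_jump[OF seg] hybrid_arc_continuous_on[OF arcA]
            segment_in_flow_interval[OF seg])
      moreover have "\<mu> * (norm x)\<^sup>2 \<le> hybrid_integral j i \<tau> (\<lambda>s k. x \<bullet> (?\<Phi> s k *v x))" for x
      proof -
        let ?f = "\<lambda>s k. x \<bullet> (?\<Phi> s k *v x)"
        have intf: "(\<lambda>s. ?f s k) integrable_on {\<tau> k..\<tau> (Suc k)}" if "k \<in> {j..i}" for k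
          using hybrid_integrable_linear[OF bounded_linear_quadratic_form int] that
          by (auto simp: hybrid_integrable_def)
        define u where "u = max t (b + 1)"
        have u: "(u, i) \<in> D" "b < u" by (auto simp: u_def intro: flow_unbounded)
        obtain v where v: "u + K \<le> v" "v \<le> u + K + 1"
          and ge: "\<mu> * (norm x)\<^sup>2 \<le> integral {u..v} (\<lambda>s. ?f s i)"
          using flow_window[OF u] by blast
        have "\<sigma> i \<le> b" using breakpointsD(4)[OF \<sigma> order_refl _ bi] T(1) K by simp
        then have sub: "{u..v} \<subseteq> {\<tau> i..\<tau> (Suc i)}"
          using v(2) T K unfolding last by (auto simp: \<tau>_def u_def)
        note ge
        also have "integral {u..v} (\<lambda>s. ?f s i) \<le> integral {\<tau> i..\<tau> (Suc i)} (\<lambda>s. ?f s i)"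
          using ji segment_in_domain[OF seg, of i]
          by (intro integral_subset_le[OF sub] integrable_on_subinterval[OF intf sub] intf ballI nonneg)
            auto
        also have "\<dots> \<le> (\<Sum>k=j..i. integral {\<tau> k..\<tau> (Suc k)} (\<lambda>s. ?f s k))"
        proof (rule member_le_sum)
          fix k assume "k \<in> {j..i} - {i}"
          then have k: "k \<in> {j..i}" by simp
          show "0 \<le> integral {\<tau> k..\<tau> (Suc k)} (\<lambda>s. ?f s k)"
            by (rule integral_nonneg[OF intf[OF k]]) (rule nonneg[OF segment_in_domain[OF seg k]])
        qed (use ji in auto)
        also have "\<dots> \<le> hybrid_integral j i \<tau> ?f"
        proof -
          have "0 \<le> ?f (\<tau> (Suc k)) k" if "k \<in> {j..<i}" for k
            using that segment_in_order(1)[OF seg, of k]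
            by (intro nonneg segment_in_domain[OF seg]) auto
          then have "0 \<le> (\<Sum>k=j..<i. ?f (\<tau> (Suc k)) k)" by (rule sum_nonneg)
          then show ?thesis by (simp add: hybrid_integral_def)
        qed
        finally show ?thesis .
      qed
      ultimately show ?thesis
        by (intro exI[of _ i] exI[of _ \<tau>]) (simp add: psd_le_hybrid_integral_iff[OF seg int sym])
    qed
  qed
qed

section \<open>Uniform observability\<close>

text \<open>With \<open>P = I\<close> the flow inequality is \<open>-2A \<le> -A\<close> and the jump inequality is
  \<open>(I - B)\<^sup>2 - I = -2B + B\<^sup>2 \<le> -B\<close>.\<close>

lemma lyapunov_inequalities_identity:
  fixes A B :: "real \<Rightarrow> nat \<Rightarrow> real^'n^'n"
  assumes dom: "hybrid_time_domain D"
    and A: "\<And>t j. (t, j) \<in> D \<Longrightarrow> psd (A t j)"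
    and B: "\<And>t j. (t, j) \<in> D \<Longrightarrow> psd (B t j) \<and> mat_norm (B t j) \<le> 1"
  shows "lyapunov_inequalities D A B (\<lambda>_ _. mat 1) A B"
  unfolding lyapunov_inequalities_def
proof (intro conjI allI ballI impI)
  show "hybrid_arc D (\<lambda>_ _. mat 1 :: real^'n^'n)" by (rule hybrid_arc_const[OF dom])
  have "psd (0 :: real^'n^'n)" by (simp add: psd_def transpose_def vec_eq_iff)
  then show "\<exists>p\<^sub>1>0. \<exists>p\<^sub>2>0. \<forall>(t, j)\<in>D. p\<^sub>1 *\<^sub>R mat 1 \<preceq> (mat 1 :: real^'n^'n) \<and> mat 1 \<preceq> p\<^sub>2 *\<^sub>R (mat 1 :: real^'n^'n)"
    by (intro exI[of _ 1] conjI) (auto simp: psd_le_def)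
next
  fix j t assume "t \<in> interior (flow_interval D j)"
  then have tj: "(t, j) \<in> D" using interior_subset by (force simp: flow_interval_def)
  show "(\<lambda>s. mat 1 :: real^'n^'n) differentiable at t" by simp
  have "transpose (A t j) = A t j" using A[OF tj] by (simp add: psd_def)
  then show "vector_derivative (\<lambda>s. mat 1) (at t) - transpose (A t j) ** mat 1 - mat 1 ** A t j \<preceq> - A t j"
    using A[OF tj] by (simp add: psd_le_def)
next
  fix t j assume "(t, j) \<in> D \<and> (t, Suc j) \<in> D"
  then have B': "psd (B t j)" "mat_norm (B t j) \<le> 1" using B by auto
  have sym: "transpose (B t j) = B t j" using B' by (simp add: psd_def)
  have "(mat 1 - B t j) ** (mat 1 - B t j) = mat 1 - B t j - B t j + B t j ** B t j"
    by (simp add: bounded_bilinear.diff_left[OF bounded_bilinear_matrix_mult]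
        bounded_bilinear.diff_right[OF bounded_bilinear_matrix_mult])
  then show "transpose (mat 1 - B t j) ** mat 1 ** (mat 1 - B t j) - mat 1 \<preceq> - B t j"
    using psd_diff_square[OF B'] by (simp add: psd_le_def transpose_diff sym)
qed (use A B in auto)

theorem theorem3:
  fixes D :: "(real \<times> nat) set"
    and A B :: "real \<Rightarrow> nat \<Rightarrow> real^'n^'n"
  assumes domain: "hybrid_time_domain D"
    and bounded: "\<exists>a>0. \<exists>b>0. \<forall>(t, j)\<in>D. mat_norm (A t j) \<le> a \<and> mat_norm (B t j) \<le> b"
    and structure_A: "\<forall>(t, j)\<in>D. transpose (A t j) = A t j \<and> 0 \<preceq> A t j"
    and structure_B: "\<forall>(t, j)\<in>D. transpose (B t j) = B t j \<and> 0 \<preceq> B t j \<and> mat_norm (B t j) \<le> 1"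
    and HPE: "HPE D A B"
  shows "HUO D A B"
proof -
  have psdA: "psd (A t j)" if "(t, j) \<in> D" for t j using structure_A that by (auto simp: psd_le_def)
  have psdB: "psd (B t j) \<and> mat_norm (B t j) \<le> 1" if "(t, j) \<in> D" for t j
    using structure_B that by (auto simp: psd_le_def)
  obtain a b where ab: "a > 0" "\<forall>(t, j)\<in>D. mat_norm (A t j) \<le> a \<and> mat_norm (B t j) \<le> b"
    using bounded by blast
  \<comment> \<open>\<open>c\<close> bounds both \<open>A\<close> and \<open>B\<close>, as \<open>|B| \<le> 1\<close>.\<close>
  define c where "c = max a 1"
  have c: "0 < c" using ab(1) by (simp add: c_def)
  let ?\<Phi> = "flow_jump D A B"
  have \<Phi>: "psd (?\<Phi> t j) \<and> mat_norm (?\<Phi> t j) \<le> c" if "(t, j) \<in> D" for t j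
    using psdA[OF that] psdB[OF that] ab(2) that by (auto simp: flow_jump_def c_def)
  obtain K\<^sub>0 \<mu> where pos: "0 < K\<^sub>0" "0 < \<mu>" and arcA: "hybrid_arc D A"
    and excited: "\<And>t j. (t, j) \<in> D \<Longrightarrow> window_integral_ge D t j K\<^sub>0 \<mu> ?\<Phi>"
    using HPE unfolding HPE_def by blast
  obtain K where K: "0 < K" and windows: "\<forall>(t, j)\<in>D. \<exists>m \<tau>. shortest_window D t j K m \<tau> \<and>
      (\<forall>i\<in>{j..<m}. \<tau> (Suc i) \<notin> interior (flow_interval D i)) \<and>
      hybrid_integrable j m \<tau> ?\<Phi> \<and> \<mu> *\<^sub>R mat 1 \<preceq> hybrid_integral j m \<tau> ?\<Phi>"
    using windows_without_branch_jumps[OF domain arcA pos(1) conjunct1[OF \<Phi>] excited] by blast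
  obtain M where M: "transition_matrix D A B M"
    using transition_matrix_exists[OF domain arcA] by blast
  define L where "L = K + 1"
  define \<kappa> where "\<kappa> = \<mu> / (2 + c * L * (L + c)\<^sup>2 / 2)"
  have L: "0 < L" using K by (simp add: L_def)
  have \<kappa>: "0 < \<kappa>" unfolding \<kappa>_def using pos(2) c L by (intro divide_pos_pos add_pos_nonneg) auto
  have observed: "window_integral_ge D t j K \<kappa>
      (\<lambda>s i. transpose (M (s, i) (t, j)) ** ?\<Phi> s i ** M (s, i) (t, j))" if tj: "(t, j) \<in> D" for t j
  proof -
    define X where "X s i = M (s, i) (t, j)" for s i
    have X0: "X t j = mat 1"
      and X_flow: "\<And>s i. (s, i) \<in> D \<Longrightarrow> t \<le> s \<Longrightarrow> j \<le> i \<Longrightarrow>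
        ((\<lambda>s. X s i) has_vector_derivative - (A s i ** X s i)) (at s within flow_interval D i \<inter> {t..})"
      and X_jump: "\<And>s i. (s, i) \<in> D \<Longrightarrow> (s, Suc i) \<in> D \<Longrightarrow> t \<le> s \<Longrightarrow> j \<le> i \<Longrightarrow>
        X s (Suc i) = (mat 1 - B s i) ** X s i"
      using M tj unfolding transition_matrix_def X_def by fast+
    let ?\<Psi> = "\<lambda>s i. transpose (X s i) ** ?\<Phi> s i ** X s i"
    obtain m \<tau> where W: "shortest_window D t j K m \<tau>"
      and jumps: "\<forall>i\<in>{j..<m}. \<tau> (Suc i) \<notin> interior (flow_interval D i)"
      and int: "hybrid_integrable j m \<tau> ?\<Phi>" and ge: "\<mu> *\<^sub>R mat 1 \<preceq> hybrid_integral j m \<tau> ?\<Phi>"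
      using windows tj by blast
    have seg: "segment_in D t j m \<tau>" using W by (simp add: shortest_window_def)
    have X_der: "((\<lambda>s. X s i) has_vector_derivative - (A s i ** X s i)) (at s within {\<tau> i..\<tau> (Suc i)})"
      if i: "i \<in> {j..m}" and s: "s \<in> {\<tau> i..\<tau> (Suc i)}" for i s
    proof (rule has_vector_derivative_within_subset[OF X_flow])
      show "(s, i) \<in> D" by (rule segment_in_domain[OF seg i s])
      show "t \<le> s" "j \<le> i" using segment_in_order(2)[OF seg i] s i by auto
      show "{\<tau> i..\<tau> (Suc i)} \<subseteq> flow_interval D i \<inter> {t..}"
        using segment_in_flow_interval[OF seg i] segment_in_order(2)[OF seg i] by auto
    qed
    have int\<Psi>: "hybrid_integrable j m \<tau> ?\<Psi>"
    proof -
      have "hybrid_integrable j m \<tau> (flow_jump D (\<lambda>s i. transpose (X s i) ** A s i ** X s i)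
          (\<lambda>s i. transpose (X s i) ** B s i ** X s i))"
      proof (rule hybrid_integrable_flow_jump[OF seg])
        fix i assume i: "i \<in> {j..m}"
        have "continuous_on {\<tau> i..\<tau> (Suc i)} (\<lambda>s. X s i)"
          by (rule continuous_on_vector_derivative) (rule X_der[OF i])
        moreover have "continuous_on {\<tau> i..\<tau> (Suc i)} (\<lambda>s. A s i)"
          by (rule hybrid_arc_continuous_on[OF arcA segment_in_flow_interval[OF seg i]])
        ultimately show "continuous_on {\<tau> i..\<tau> (Suc i)} (\<lambda>s. transpose (X s i) ** A s i ** X s i)"
          by (intro bounded_bilinear.continuous_on[OF bounded_bilinear_matrix_mult]
              bounded_linear.continuous_on[OF bounded_linear_transpose])
      qed
      moreover have "flow_jump D (\<lambda>s i. transpose (X s i) ** A s i ** X s i)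
          (\<lambda>s i. transpose (X s i) ** B s i ** X s i) = ?\<Psi>"
        by (intro ext) (simp add: flow_jump_def)
      ultimately show ?thesis by simp
    qed
    have "\<kappa> * (norm x)\<^sup>2 \<le> hybrid_integral j m \<tau> (\<lambda>s i. x \<bullet> (?\<Psi> s i *v x))" for x
    proof -
      define \<zeta> where "\<zeta> s i = X s i *v x" for s i
      have q: "x \<bullet> (?\<Psi> s i *v x) = \<zeta> s i \<bullet> (?\<Phi> s i *v \<zeta> s i)" for s i
        by (simp add: \<zeta>_def quadratic_form_conj)
      have "\<kappa> * (norm (\<zeta> t j))\<^sup>2 \<le> hybrid_integral j m \<tau> (\<lambda>s i. \<zeta> s i \<bullet> (?\<Phi> s i *v \<zeta> s i))"
        unfolding \<kappa>_def
      proof (rule excitation_imp_observability[OF seg _ c L pos(2) \<Phi> _ _ _ int _ ge])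
        show "segment_length j m \<tau> \<le> L" unfolding L_def by (rule shortest_window_length_le[OF W K])
        show "((\<lambda>s. \<zeta> s i) has_vector_derivative - (A s i *v \<zeta> s i)) (at s within {\<tau> i..\<tau> (Suc i)})"
          if "i \<in> {j..m}" "s \<in> {\<tau> i..\<tau> (Suc i)}" for i s
          using bounded_linear.has_vector_derivative[OF bounded_linear_mult_vec X_der[OF that], of x]
          by (simp add: \<zeta>_def matrix_vector_mul_assoc
              linear_neg[OF bounded_linear.linear[OF bounded_linear_mult_vec]])
        show "- (A s i *v \<zeta> s i) = - (?\<Phi> s i *v \<zeta> s i)"
          if "i \<in> {j..m}" "s \<in> {\<tau> i<..<\<tau> (Suc i)}" for i s
          using segment_in_interior[OF seg that] by (simp add: flow_jump_def)
        show "\<zeta> (\<tau> (Suc i)) (Suc i) = \<zeta> (\<tau> (Suc i)) i - ?\<Phi> (\<tau> (Suc i)) i *v \<zeta> (\<tau> (Suc i)) i"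
          if i: "i \<in> {j..<m}" for i
        proof -
          have i': "i \<in> {j..m}" "Suc i \<in> {j..m}" using i by auto
          have "(\<tau> (Suc i), i) \<in> D" "(\<tau> (Suc i), Suc i) \<in> D"
            using segment_in_order(1)[OF seg] i' by (auto intro!: segment_in_domain[OF seg])
          then have "X (\<tau> (Suc i)) (Suc i) = (mat 1 - B (\<tau> (Suc i)) i) ** X (\<tau> (Suc i)) i"
            using X_jump segment_in_order(2)[OF seg i'(2)] i by auto
          moreover have "?\<Phi> (\<tau> (Suc i)) i = B (\<tau> (Suc i)) i" using jumps i by (simp add: flow_jump_def)
          ultimately show ?thesis
            by (simp add: \<zeta>_def matrix_vector_mult_diff_rdistrib flip: matrix_vector_mul_assoc)
        qed
        show "hybrid_integrable j m \<tau> (\<lambda>s i. \<zeta> s i \<bullet> (?\<Phi> s i *v \<zeta> s i))"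
          using hybrid_integrable_linear[OF bounded_linear_quadratic_form int\<Psi>, of x] by (simp add: q)
      qed
      then show ?thesis by (simp add: q) (simp add: \<zeta>_def X0)
    qed
    moreover have "transpose (?\<Psi> s i) = ?\<Psi> s i" if "(s, i) \<in> D" for s i
      using \<Phi>[OF that] by (simp add: transpose_conj psd_def)
    ultimately have "\<kappa> *\<^sub>R mat 1 \<preceq> hybrid_integral j m \<tau> ?\<Psi>"
      by (simp add: psd_le_hybrid_integral_iff[OF seg int\<Psi>])
    with W int\<Psi> show ?thesis unfolding window_integral_ge_def X_def by blast
  qed
  have "lyapunov_inequalities D A B (\<lambda>_ _. mat 1) A B"
    by (rule lyapunov_inequalities_identity[OF domain psdA psdB])
  moreover have "\<forall>(t\<^sub>0, j\<^sub>0)\<in>D. window_integral_ge D t\<^sub>0 j\<^sub>0 K \<kappa>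
      (\<lambda>s i. transpose (M (s, i) (t\<^sub>0, j\<^sub>0)) ** ?\<Phi> s i ** M (s, i) (t\<^sub>0, j\<^sub>0))"
    using observed by blast
  ultimately show ?thesis
    unfolding HUO_def using M K \<kappa> by blast
qed

end
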